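(* Let $d\ge 3$, let $S$ be the subordinator with Laplace exponent $\phi(\lambda)=\frac{\lambda}{\ln(1+\lambda)}-1$, let $\mu(t)$ be the density of its Lévy measure, and let \[ j(r)=(4\pi)^{-d/2}\int_0^\infty t^{-d/2}e^{-r^2/(4t)}\mu(t)\,dt,\qquad r>0, \] so that $y\mapsto j(|y|)$ is the Lévy density of the Lévy process in $\mathbb{R}^d$ with characteristic exponent $\Phi(\xi)=\phi(|\xi|^2)=\frac{|\xi|^2}{\ln(1+|\xi|^2)}-1$. Then \[ j(r)\sim \frac{4\,\Gamma(\frac d2+1)}{\pi^{d/2}}\cdot\frac{1}{r^{d+2}\left(\ln\frac{1}{r^2}\right)^2}\quad\text{as } r\to0+. \]
   Context: $f\sim g$ means that the ratio $f/g$ tends to $1$ in the indicated limit; $\Gamma$ is the Gamma function. A subordinator $S=(S_t)_{t\ge0}$ is a $[0,\infty)$-valued Lévy process started at $0$; its Laplace exponent $\phi$ is given by $\mathbb{E}e^{-\lambda S_t}=e^{-t\phi(\lambda)}$, $\lambda>0$. The function $\phi(\lambda)=\frac{\lambda}{\ln(1+\lambda)}-1$ is a complete Bernstein function with zero drift, i.e. $\phi(\lambda)=\int_0^\infty(1-e^{-\lambda t})\mu(t)\,dt$ where $\mu:(0,\infty)\to(0,\infty)$ is completely monotone and $\int_0^\infty(1\wedge t)\mu(t)\,dt<\infty$; this $\mu$ is the density of the Lévy measure of $S$. The characteristic exponent of a Lévy process $X$ is given by $\mathbb{E}_x[e^{i\xi\cdot(X_t-X_0)}]=e^{-t\Phi(\xi)}$.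 *)

theory Defs
  imports "HOL-Probability.Probability" "HOL-Library.Landau_Symbols"
begin

text \<open>
  Processes are functions on all of \<^typ>\<open>real\<close>; only their values at times \<open>t \<ge> 0\<close> matter.
  Since \<open>X 0 = x\<close> almost surely, independence from the initial value need not be required separately.
\<close>

definition levy_process ::
    "'w measure \<Rightarrow> 'b::euclidean_space \<Rightarrow> (real \<Rightarrow> 'w \<Rightarrow> 'b) \<Rightarrow> bool" where
  "levy_process M x X \<longleftrightarrow>
     prob_space M \<and>
     (\<forall>t\<ge>0. X t \<in> borel_measurable M) \<and>
     (AE \<omega> in M. X 0 \<omega> = x) \<and>
     (\<forall>ts. sorted_wrt (<) ts \<and> set ts \<subseteq> {0..} \<longrightarrow>
        prob_space.indep_vars M (\<lambda>_. borel) (\<lambda>i \<omega>. X (ts ! Suc i) \<omega> - X (ts ! i) \<omega>)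
          {i. Suc i < length ts}) \<and>
     (\<forall>s\<ge>0. \<forall>h\<ge>0. distr M borel (\<lambda>\<omega>. X (s + h) \<omega> - X s \<omega>) = distr M borel (\<lambda>\<omega>. X h \<omega> - X 0 \<omega>)) \<and>
     (AE \<omega> in M. (\<forall>t\<ge>0. ((\<lambda>s. X s \<omega>) \<longlongrightarrow> X t \<omega>) (at_right t)) \<and>
                 (\<forall>t>0. \<exists>l. ((\<lambda>s. X s \<omega>) \<longlongrightarrow> l) (at_left t)))"

definition subordinator :: "'w measure \<Rightarrow> (real \<Rightarrow> 'w \<Rightarrow> real) \<Rightarrow> bool" where
  "subordinator M S \<longleftrightarrow>
     levy_process M 0 S \<and> (\<forall>t\<ge>0. \<forall>\<omega>\<in>space M. 0 \<le> S t \<omega>)"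

definition has_laplace_exponent :: "'w measure \<Rightarrow> (real \<Rightarrow> 'w \<Rightarrow> real) \<Rightarrow> (real \<Rightarrow> real) \<Rightarrow> bool" where
  "has_laplace_exponent M S f \<longleftrightarrow>
     (\<forall>t\<ge>0. \<forall>l>0. (\<integral>\<omega>. exp (- l * S t \<omega>) \<partial>M) = exp (- t * f l))"

definition has_characteristic_exponent ::
    "'w measure \<Rightarrow> (real \<Rightarrow> 'w \<Rightarrow> 'b::euclidean_space) \<Rightarrow> ('b \<Rightarrow> complex) \<Rightarrow> bool" where
  "has_characteristic_exponent M X \<Phi> \<longleftrightarrow>
     (\<forall>t\<ge>0. \<forall>\<xi>. (\<integral>\<omega>. iexp (\<xi> \<bullet> (X t \<omega> - X 0 \<omega>)) \<partial>M) = exp (- of_real t * \<Phi> \<xi>))"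

text \<open>
  The Levy measure of a subordinator is the measure \<open>\<nu>\<close> on \<open>(0,\<infinity>)\<close> (here a Borel measure on the line
  that does not charge \<open>(-\<infinity>,0]\<close>) in the representation
  \<open>b \<lambda> + \<integral> (1 - exp (- \<lambda> t)) \<nu>(dt)\<close> of its Laplace exponent, \<open>b \<ge> 0\<close> being the drift.
\<close>

definition has_subordinator_levy_measure ::
    "'w measure \<Rightarrow> (real \<Rightarrow> 'w \<Rightarrow> real) \<Rightarrow> real measure \<Rightarrow> bool" where
  "has_subordinator_levy_measure M S \<nu> \<longleftrightarrow>
     sets \<nu> = sets borel \<and> emeasure \<nu> {..0} = 0 \<and> (\<integral>\<^sup>+t. ennreal (min 1 t) \<partial>\<nu>) < \<infinity> \<and>
     (\<exists>b\<ge>0. has_laplace_exponent M S (\<lambda>l. b * l + (\<integral>t. (1 - exp (- l * t)) \<partial>\<nu>)))"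

definition has_subordinator_levy_density ::
    "'w measure \<Rightarrow> (real \<Rightarrow> 'w \<Rightarrow> real) \<Rightarrow> (real \<Rightarrow> real) \<Rightarrow> bool" where
  "has_subordinator_levy_density M S \<mu> \<longleftrightarrow>
     set_borel_measurable borel {0<..} \<mu> \<and> (\<forall>t>0. 0 \<le> \<mu> t) \<and>
     has_subordinator_levy_measure M S (density lborel (\<lambda>t. ennreal (indicator {0<..} t * \<mu> t)))"

text \<open>
  The Levy measure of a Levy process is the measure \<open>\<nu>\<close> in the Levy-Khintchine representation of
  its characteristic exponent; \<open>A\<close> is the Gaussian covariance operator and \<open>\<gamma>\<close> the drift relative
  to truncation at the closed unit ball.
\<close>

definition has_levy_measure ::
    "'w measure \<Rightarrow> (real \<Rightarrow> 'w \<Rightarrow> 'b::euclidean_space) \<Rightarrow> 'b measure \<Rightarrow> bool" where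
  "has_levy_measure M X \<nu> \<longleftrightarrow>
     sets \<nu> = sets borel \<and> emeasure \<nu> {0} = 0 \<and>
     (\<integral>\<^sup>+y. ennreal (min 1 ((norm y)\<^sup>2)) \<partial>\<nu>) < \<infinity> \<and>
     (\<exists>(A :: 'b \<Rightarrow> 'b) \<gamma>.
        linear A \<and> (\<forall>u v. A u \<bullet> v = u \<bullet> A v) \<and> (\<forall>u. 0 \<le> u \<bullet> A u) \<and>
        has_characteristic_exponent M X (\<lambda>\<xi>.
          of_real (\<xi> \<bullet> A \<xi> / 2) - \<i> * of_real (\<gamma> \<bullet> \<xi>)
          - (\<integral>y. (iexp (\<xi> \<bullet> y) - 1 - \<i> * of_real (\<xi> \<bullet> y * indicator (cball 0 1) y)) \<partial>\<nu>)))"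

definition has_levy_density ::
    "'w measure \<Rightarrow> (real \<Rightarrow> 'w \<Rightarrow> 'b::euclidean_space) \<Rightarrow> ('b \<Rightarrow> real) \<Rightarrow> bool" where
  "has_levy_density M X f \<longleftrightarrow>
     f \<in> borel_measurable borel \<and> (\<forall>y. y \<noteq> 0 \<longrightarrow> 0 \<le> f y) \<and>
     has_levy_measure M X (density lborel (\<lambda>y. ennreal (f y)))"

text \<open>Complete monotonicity on \<open>(0,\<infinity>)\<close>; \<open>D n\<close> is the \<open>n\<close>-th derivative of \<open>f\<close> there.\<close>

definition completely_monotone :: "(real \<Rightarrow> real) \<Rightarrow> bool" where
  "completely_monotone f \<longleftrightarrow>
     (\<exists>D :: nat \<Rightarrow> real \<Rightarrow> real.
        (\<forall>t>0. D 0 t = f t) \<and>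
        (\<forall>n. \<forall>t>0. (D n has_real_derivative D (Suc n) t) (at t) \<and> 0 \<le> (- 1) ^ n * D n t))"

text \<open>
  The value at \<open>0\<close> is the continuous extension. It is needed because the formula, read with
  \<open>0 / 0 = 0\<close>, would give \<open>- 1\<close>, whereas a characteristic exponent vanishes at the origin.
\<close>

definition phi :: "real \<Rightarrow> real" where
  "phi l = (if l = 0 then 0 else l / ln (1 + l) - 1)"

definition levy_kernel :: "nat \<Rightarrow> (real \<Rightarrow> real) \<Rightarrow> real \<Rightarrow> real" where
  "levy_kernel d \<mu> r =
     (4 * pi) powr (- real d / 2) *
     (LBINT t:{0<..}. t powr (- real d / 2) * exp (- r\<^sup>2 / (4 * t)) * \<mu> t)"

end

theory Submission
  imports Defs "HOL-Real_Asymp.Real_Asymp"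
begin

text \<open>
  Since \<open>\<lambda> / ln (1 + \<lambda>)\<close> is the integral of \<open>(1 + \<lambda>)\<^sup>x\<close> over \<open>x \<in> (0,1)\<close>, the exponent \<open>\<phi>\<close> is a mixture of
  the tempered stable exponents \<open>(1 + \<lambda>)\<^sup>x - 1\<close>, whose Levy densities are
  \<open>x / \<Gamma>(1 - x) \<cdot> t powr (-1 - x) \<cdot> exp (- t)\<close>. Levy measures of subordinators are unique: integrals
  of \<open>1 - exp (- \<lambda> t)\<close> determine the moments of the image of a finite measure under
  \<open>t \<mapsto> exp (- t)\<close>, and measures on \<open>[0,1]\<close> are determined by their moments. Hence \<open>\<mu>\<close> is the mixture
  of these densities almost everywhere, and with \<open>L = - ln (r\<^sup>2 / 4)\<close> the substitutions
  \<open>t = r\<^sup>2 / (4 s)\<close> and \<open>x = 1 - u / L\<close> put \<open>j(r)\<close> into a form to which dominated convergence applies.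
  The factor \<open>L powr (-2)\<close> comes from \<open>dx = du / L\<close> and from \<open>1 / \<Gamma>(u / L) \<sim> u / L\<close>.
  That \<open>j\<close> is the Levy density of the subordinate process is Tonelli's theorem and the Fourier
  transform of the heat kernel.
\<close>

subsection \<open>The heat kernel\<close>

lemma gaussian_fourier_real:
  fixes s t :: real
  assumes t: "t > 0"
  shows "has_bochner_integral lborel (\<lambda>x. of_real (exp (- x\<^sup>2 / (4 * t))) * iexp (s * x))
    (of_real (sqrt (4 * pi * t) * exp (- t * s\<^sup>2)))"
proof -
  define c where "c = sqrt (2 * t)"
  have c: "c > 0" "c\<^sup>2 = 2 * t"
    using t by (auto simp: c_def)
  interpret real_distribution std_normal_distribution
    by (rule real_dist_normal_dist)
  have "integrable std_normal_distribution (\<lambda>x. iexp (s * c * x))"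
    by (intro integrable_const_bound[where B=1]) auto
  hence "has_bochner_integral std_normal_distribution (\<lambda>x. iexp (s * c * x))
    (char std_normal_distribution (s * c))"
    unfolding char_def by (rule has_bochner_integral_integrable)
  hence "has_bochner_integral lborel (\<lambda>x. std_normal_density x *\<^sub>R iexp (s * c * x))
    (of_real (exp (- (s * c)\<^sup>2 / 2)))"
    by (simp add: has_bochner_integral_iff integrable_density integral_density char_std_normal_distribution)
  hence "has_bochner_integral lborel (\<lambda>x. sqrt (2 * pi) *\<^sub>R (std_normal_density x *\<^sub>R iexp (s * c * x)))
    (sqrt (2 * pi) *\<^sub>R of_real (exp (- (s * c)\<^sup>2 / 2)))"
    by (rule has_bochner_integral_scaleR_right)
  \<comment> \<open>Since \<open>c\<^sup>2 = 2 * t\<close>, the standard normal exponent at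
    \<open>x\<close> equals the wanted Gaussian exponent at \<open>c * x\<close>. The shape
    \<open>0 + c * x\<close> prepares the affine substitution that closes the proof.\<close>
  also have "(\<lambda>x. sqrt (2 * pi) *\<^sub>R (std_normal_density x *\<^sub>R iexp (s * c * x))) =
    (\<lambda>x. of_real (exp (- (0 + c * x)\<^sup>2 / (4 * t))) * iexp (s * (0 + c * x)))"
    using t c by (auto simp: std_normal_density_def scaleR_conv_of_real fun_eq_iff power_mult_distrib
      mult_ac real_sqrt_mult)
  also have "sqrt (2 * pi) *\<^sub>R complex_of_real (exp (- (s * c)\<^sup>2 / 2)) =
     complex_of_real (sqrt (4 * pi * t) * exp (- t * s\<^sup>2)) /\<^sub>R \<bar>c\<bar>"
  proof -
    have "sqrt (4 * pi * t) = sqrt (2 * pi) * c"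
      by (simp add: c_def real_sqrt_mult[symmetric])
    thus ?thesis
      using c by (simp add: scaleR_conv_of_real power_mult_distrib mult_ac)
  qed
  finally show ?thesis
    using lborel_has_bochner_integral_real_affine_iff[of c
      "\<lambda>x. of_real (exp (- x\<^sup>2 / (4 * t))) * iexp (s * x)" _ 0] c
    by auto
qed

text \<open>Gaussian and character both factor over the coordinates, and Lebesgue measure is the
  image of the product measure under the coordinate map, so the integral is a product of
  one-dimensional ones.\<close>

lemma gaussian_fourier:
  fixes \<xi> :: "'a::euclidean_space"
  assumes t: "t > 0"
  shows "has_bochner_integral lborel
    (\<lambda>y::'a. of_real (exp (- (norm y)\<^sup>2 / (4 * t))) * iexp (\<xi> \<bullet> y))
    (of_real ((4 * pi * t) powr (real DIM('a) / 2) * exp (- t * (norm \<xi>)\<^sup>2)))"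
proof -
  interpret product_sigma_finite "\<lambda>_::'a. lborel :: real measure" ..
  let ?g = "\<lambda>b x. complex_of_real (exp (- x\<^sup>2 / (4 * t))) * iexp (\<xi> \<bullet> b * x)"
  let ?f = "\<lambda>y::'a. complex_of_real (exp (- (norm y)\<^sup>2 / (4 * t))) * iexp (\<xi> \<bullet> y)"
  let ?T = "\<lambda>f. \<Sum>b\<in>Basis. f b *\<^sub>R (b::'a)"
  have norm2: "(norm y)\<^sup>2 = (\<Sum>b\<in>Basis. (y \<bullet> b)\<^sup>2)" for y :: 'a
    by (subst power2_norm_eq_inner, subst euclidean_inner) (simp add: power2_eq_square)
  have f_eq: "?f y = (\<Prod>b\<in>Basis. ?g b (y \<bullet> b))" for y
  proof -
    have "exp (- (norm y)\<^sup>2 / (4 * t)) = (\<Prod>b\<in>Basis. exp (- (y \<bullet> b)\<^sup>2 / (4 * t)))"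
      by (simp add: norm2 exp_sum[symmetric] sum_negf sum_divide_distrib)
    moreover have "iexp (\<xi> \<bullet> y) = (\<Prod>b\<in>Basis. iexp (\<xi> \<bullet> b * (y \<bullet> b)))"
      by (subst euclidean_inner) (simp add: exp_sum[symmetric] sum_distrib_left)
    ultimately show ?thesis
      by (simp add: prod.distrib)
  qed
  have fT: "?f (?T f) = (\<Prod>b\<in>Basis. ?g b (f b))" for f
    unfolding f_eq by (intro prod.cong refl) simp
  have int: "integrable lborel (?g b)" for b
    using gaussian_fourier_real[OF t, of "\<xi> \<bullet> b"] by (auto simp: has_bochner_integral_iff)
  have val: "integral\<^sup>L lborel (?g b) = of_real (sqrt (4 * pi * t) * exp (- t * (\<xi> \<bullet> b)\<^sup>2))" for b
    using gaussian_fourier_real[OF t, of "\<xi> \<bullet> b"] by (auto simp: has_bochner_integral_iff)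
  have "integrable (\<Pi>\<^sub>M b\<in>Basis. lborel) (\<lambda>f. ?f (?T f))"
    unfolding fT by (intro product_integrable_prod int) simp
  hence "integrable lborel ?f"
    by (subst lborel_eq, subst integrable_distr_eq) auto
  moreover have "integral\<^sup>L lborel ?f = integral\<^sup>L (\<Pi>\<^sub>M b\<in>Basis. lborel) (\<lambda>f. ?f (?T f))"
    by (subst lborel_eq, subst integral_distr) auto
  moreover have "\<dots> = (\<Prod>b\<in>Basis. integral\<^sup>L lborel (?g b))"
    unfolding fT by (intro product_integral_prod int) simp
  moreover have "(\<Prod>b\<in>(Basis::'a set). integral\<^sup>L lborel (?g b)) =
      of_real ((4 * pi * t) powr (real DIM('a) / 2) * exp (- t * (norm \<xi>)\<^sup>2))"
  proof -
    have "(4 * pi * t) powr (real DIM('a) / 2) = sqrt (4 * pi * t) ^ DIM('a)"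
      using t by (simp add: powr_half_sqrt[symmetric] powr_realpow[symmetric] powr_powr)
    moreover have "(\<Prod>b\<in>(Basis::'a set). exp (- t * (\<xi> \<bullet> b)\<^sup>2)) = exp (- t * (norm \<xi>)\<^sup>2)"
      unfolding norm2 by (simp add: exp_sum[symmetric] sum_distrib_left sum_negf)
    ultimately show ?thesis
      unfolding val of_real_prod[symmetric] prod.distrib by simp
  qed
  ultimately show ?thesis
    by (simp add: has_bochner_integral_iff)
qed

section \<open>Cosine transform of the heat kernel and a bound on its spread\<close>

text \<open>This is the kernel of the semigroup generated by the Laplacian without the factor 1/2,
  so that its Fourier transform is \<open>exp (- t * (norm \<xi>)\<^sup>2)\<close>.\<close>

definition heat_kernel :: "real \<Rightarrow> 'a::euclidean_space \<Rightarrow> real" where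
  "heat_kernel t y = (4 * pi * t) powr (- real DIM('a) / 2) * exp (- (norm y)\<^sup>2 / (4 * t))"

lemma heat_kernel_nonneg: "0 \<le> heat_kernel t y"
  by (simp add: heat_kernel_def)

lemma has_integral_heat_kernel_cos:
  fixes \<xi> :: "'a::euclidean_space"
  assumes t: "t > 0"
  shows "has_bochner_integral lborel (\<lambda>y. heat_kernel t y * cos (\<xi> \<bullet> y)) (exp (- t * (norm \<xi>)\<^sup>2))"
proof -
  have "has_bochner_integral lborel
    (\<lambda>y::'a. Re (of_real ((4 * pi * t) powr (- real DIM('a) / 2)) *
       (of_real (exp (- (norm y)\<^sup>2 / (4 * t))) * iexp (\<xi> \<bullet> y))))
    (Re (of_real ((4 * pi * t) powr (- real DIM('a) / 2)) *
      of_real ((4 * pi * t) powr (real DIM('a) / 2) * exp (- t * (norm \<xi>)\<^sup>2))))"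
    by (intro has_bochner_integral_Re has_bochner_integral_mult_right gaussian_fourier t)
  thus ?thesis
    using t by (simp add: heat_kernel_def Re_exp mult_ac powr_minus field_simps)
qed

lemma nn_integral_heat_kernel_cos:
  fixes \<xi> :: "'a::euclidean_space"
  assumes t: "t > 0"
  shows "(\<integral>\<^sup>+y. ennreal (heat_kernel t y * (1 - cos (\<xi> \<bullet> y))) \<partial>lborel) = ennreal (1 - exp (- t * (norm \<xi>)\<^sup>2))"
proof -
  have "has_bochner_integral lborel
      (\<lambda>y. heat_kernel t y * cos ((0::'a) \<bullet> y) - heat_kernel t y * cos (\<xi> \<bullet> y))
      (exp (- t * (norm (0::'a))\<^sup>2) - exp (- t * (norm \<xi>)\<^sup>2))"
    by (intro has_bochner_integral_diff has_integral_heat_kernel_cos t)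
  hence "has_bochner_integral lborel (\<lambda>y. heat_kernel t y * (1 - cos (\<xi> \<bullet> y))) (1 - exp (- t * (norm \<xi>)\<^sup>2))"
    by (simp add: algebra_simps)
  thus ?thesis
    by (subst nn_integral_eq_integral) (auto simp: heat_kernel_nonneg has_bochner_integral_iff)
qed

text \<open>The function \<open>1 - exp (- (norm y)\<^sup>2)\<close> stands in for
  \<open>min 1 ((norm y)\<^sup>2)\<close>, because its integral against a Gaussian is explicit:
  multiplying a heat kernel by \<open>exp (- (norm y)\<^sup>2)\<close> gives a multiple of another
  heat kernel.\<close>

lemma nn_integral_heat_kernel_bound:
  assumes t: "t > 0"
  shows "(\<integral>\<^sup>+(y::'a::euclidean_space). ennreal (heat_kernel t y * (1 - exp (- (norm y)\<^sup>2))) \<partial>lborel)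
    \<le> ennreal (2 * real DIM('a) * min 1 t)"
proof -
  \<comment> \<open>The time \<open>s\<close> solves \<open>1 / (4 * s) = 1 / (4 * t) + 1\<close>,
    which makes the exponents of the two kernels match.\<close>
  define s where "s = t / (1 + 4 * t)"
  define d where "d = real DIM('a)"
  have d: "d \<ge> 1" by (simp add: d_def Suc_le_eq)
  have s: "s > 0" using t by (simp add: s_def)
  have "has_bochner_integral lborel
      (\<lambda>y::'a. heat_kernel t y * cos ((0::'a) \<bullet> y) - (1 + 4 * t) powr (- d / 2) * (heat_kernel s y * cos ((0::'a) \<bullet> y)))
      (exp (- t * (norm (0::'a))\<^sup>2) - (1 + 4 * t) powr (- d / 2) * exp (- s * (norm (0::'a))\<^sup>2))"
    by (intro has_bochner_integral_diff has_bochner_integral_mult_right has_integral_heat_kernel_cos t s)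
  moreover have "(1 + 4 * t) powr (- d / 2) * heat_kernel s y = heat_kernel t y * exp (- (norm y)\<^sup>2)" for y :: 'a
  proof -
    have "- (norm y)\<^sup>2 / (4 * s) = - (norm y)\<^sup>2 / (4 * t) + - (norm y)\<^sup>2"
      using t by (simp add: s_def field_simps)
    moreover have "(1 + 4 * t) powr (- d / 2) * (4 * pi * s) powr (- d / 2) = (4 * pi * t) powr (- d / 2)"
    proof -
      have "(1 + 4 * t) * (4 * pi * s) = 4 * pi * t"
        using t by (simp add: s_def)
      thus ?thesis
        using t s by (simp only: powr_mult[symmetric])
    qed
    moreover have "(1 + 4 * t) powr (- d / 2) * heat_kernel s y =
        (1 + 4 * t) powr (- d / 2) * (4 * pi * s) powr (- d / 2) * exp (- (norm y)\<^sup>2 / (4 * s))"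
      by (simp add: heat_kernel_def d_def)
    ultimately show ?thesis
      by (simp only: exp_add) (simp add: heat_kernel_def d_def)
  qed
  ultimately have "has_bochner_integral lborel (\<lambda>y::'a. heat_kernel t y * (1 - exp (- (norm y)\<^sup>2)))
     (1 - (1 + 4 * t) powr (- d / 2))"
    by (simp add: algebra_simps)
  hence "(\<integral>\<^sup>+(y::'a). ennreal (heat_kernel t y * (1 - exp (- (norm y)\<^sup>2))) \<partial>lborel) = ennreal (1 - (1 + 4 * t) powr (- d / 2))"
    by (subst nn_integral_eq_integral) (auto simp: heat_kernel_nonneg has_bochner_integral_iff)
  also have "\<dots> \<le> ennreal (2 * d * min 1 t)"
  proof (rule ennreal_leI)
    \<comment> \<open>This is \<open>exp a \<ge> 1 + a\<close> at
      \<open>a = - d / 2 * ln (1 + 4 * t)\<close>.\<close>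
    have "1 - (1 + 4 * t) powr (- d / 2) \<le> d / 2 * ln (1 + 4 * t)"
      using t exp_ge_add_one_self[of "- d / 2 * ln (1 + 4 * t)"] by (simp add: powr_def)
    also have "\<dots> \<le> d / 2 * (4 * t)"
      using d t ln_add_one_self_le_self[of "4 * t"] by (intro mult_left_mono) auto
    finally have "1 - (1 + 4 * t) powr (- d / 2) \<le> 2 * d * t" by simp
    moreover have "1 - (1 + 4 * t) powr (- d / 2) \<le> 2 * d * 1"
    proof -
      have "(1 + 4 * t) powr (- d / 2) \<ge> 0" by simp
      thus ?thesis using d by linarith
    qed
    ultimately show "1 - (1 + 4 * t) powr (- d / 2) \<le> 2 * d * min 1 t"
      by (cases "t \<le> 1") (auto simp: min_def)
  qed
  finally show ?thesis unfolding d_def .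
qed

subsection \<open>Uniqueness of the Levy measure of a subordinator\<close>

text \<open>On the unit interval all moments are at most 1, so the Taylor polynomials of the
  characteristic function have remainder at most \<open>2 * \<bar>t\<bar> ^ n / fact n\<close> and
  converge everywhere. Moments thus determine the characteristic function, which determines the
  distribution.\<close>

lemma real_distribution_eq_if_moments_eq:
  assumes "real_distribution M1" "real_distribution M2"
    and AE: "AE x in M1. x \<in> {0..1}" "AE x in M2. x \<in> {0..1}"
    and mom: "\<And>n. (\<integral>x. x ^ n \<partial>M1) = (\<integral>x. x ^ n \<partial>M2 :: real)"
  shows "M1 = M2"
proof (rule Levy_uniqueness)
  have lim: "(\<lambda>n. \<Sum>k\<le>n. (\<i> * t) ^ k / fact k * of_real (\<integral>x. x ^ k \<partial>M)) \<longlonglongrightarrow> char M t"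
    if "real_distribution M" and AE: "AE x in M. x \<in> {0..1}" for M t
  proof -
    interpret real_distribution M by fact
    have int: "integrable M (\<lambda>x. x ^ k)" for k
      by (rule integrable_const_bound[where B=1]) (use AE in \<open>auto simp: power_le_one\<close>)
    have le: "expectation (\<lambda>x. \<bar>x\<bar> ^ n) \<le> 1" for n
    proof -
      have "expectation (\<lambda>x. \<bar>x\<bar> ^ n) \<le> expectation (\<lambda>_. 1)"
        using AE integrable_abs[OF int[of n]]
        by (intro integral_mono_AE) (auto simp: power_le_one power_abs)
      thus ?thesis using prob_space by simp
    qed
    have "(\<lambda>n. (\<Sum>k\<le>n. (\<i> * t) ^ k / fact k * of_real (expectation (\<lambda>x. x ^ k))) - char M t) \<longlonglongrightarrow> 0"
    proof (rule Lim_null_comparison)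
      have "norm ((\<Sum>k\<le>n. (\<i> * t) ^ k / fact k * of_real (expectation (\<lambda>x. x ^ k))) - char M t)
          \<le> 2 * (\<bar>t\<bar> ^ n / fact n)" for n
      proof -
        have "norm ((\<Sum>k\<le>n. (\<i> * t) ^ k / fact k * of_real (expectation (\<lambda>x. x ^ k))) - char M t)
           \<le> (2 * \<bar>t\<bar> ^ n / fact n) * expectation (\<lambda>x. \<bar>x\<bar> ^ n)"
          by (subst norm_minus_commute) (rule char_approx1[OF int])
        also have "\<dots> \<le> (2 * \<bar>t\<bar> ^ n / fact n) * 1"
          by (intro mult_left_mono le) auto
        finally show ?thesis by simp
      qed
      thus "eventually (\<lambda>n. norm ((\<Sum>k\<le>n. (\<i> * t) ^ k / fact k * of_real (expectation (\<lambda>x. x ^ k))) - char M t)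
          \<le> 2 * (\<bar>t\<bar> ^ n / fact n)) sequentially" by simp
      have "(\<lambda>n. \<bar>t\<bar> ^ n / fact n) \<longlonglongrightarrow> 0"
        using summable_LIMSEQ_zero[OF summable_exp[of "\<bar>t\<bar>"]]
        by (simp add: field_simps)
      thus "(\<lambda>n. 2 * (\<bar>t\<bar> ^ n / fact n)) \<longlonglongrightarrow> 0"
        by (rule tendsto_mult_right_zero)
    qed
    thus ?thesis by (subst Lim_null)
  qed
  show "char M1 = char M2"
  proof
    fix t
    show "char M1 t = char M2 t"
      using lim[OF assms(1) AE(1), of t] lim[OF assms(2) AE(2), of t] unfolding mom
      by (rule LIMSEQ_unique)
  qed
qed fact+

text \<open>A Levy measure may have infinite mass near 0, so it is first weighted by a function
  \<open>w\<close> that is positive on the half-line and has a finite integral. After normalisation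
  and the map to \<open>exp (- t)\<close>, the moments are differences of Laplace integrals at
  consecutive integers.\<close>

lemma levy_measure_eqI:
  fixes \<nu>1 \<nu>2 :: "real measure"
  assumes sets: "sets \<nu>1 = sets borel" "sets \<nu>2 = sets borel"
    and pos: "AE t in \<nu>1. t > 0" "AE t in \<nu>2. t > 0"
    and eq: "\<And>l. l > 0 \<Longrightarrow> (\<integral>\<^sup>+t. ennreal (1 - exp (- l * t)) \<partial>\<nu>1) = (\<integral>\<^sup>+t. ennreal (1 - exp (- l * t)) \<partial>\<nu>2)"
    and fin: "\<And>l. l > 0 \<Longrightarrow> (\<integral>\<^sup>+t. ennreal (1 - exp (- l * t)) \<partial>\<nu>1) < \<infinity>"
  shows "\<nu>1 = \<nu>2"
proof -
  \<comment> \<open>The weight telescopes: \<open>exp (- t) ^ n * w t\<close> is the difference of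
    \<open>1 - exp (- l * t)\<close> at \<open>l = n + 2\<close> and \<open>l = n + 1\<close>.
    Starting at \<open>n + 1\<close> rather than \<open>n\<close> keeps every \<open>l\<close>
    positive.\<close>
  define w :: "real \<Rightarrow> real" where "w t = exp (- t) - exp (- 2 * t)" for t
  have [measurable]: "w \<in> borel_measurable borel" unfolding w_def by measurable
  have w_pos: "w t > 0" if "t > 0" for t using that by (simp add: w_def)
  have w_split: "(\<integral>\<^sup>+t. ennreal (exp (- t) ^ n * w t) \<partial>\<nu>) + (\<integral>\<^sup>+t. ennreal (1 - exp (- (real n + 1) * t)) \<partial>\<nu>)
     = (\<integral>\<^sup>+t. ennreal (1 - exp (- (real n + 2) * t)) \<partial>\<nu>)"
    if [measurable_cong]: "sets \<nu> = sets borel" and "AE t in \<nu>. t > 0" for \<nu> n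
  proof (subst nn_integral_add[symmetric])
    show "(\<integral>\<^sup>+t. ennreal (exp (- t) ^ n * w t) + ennreal (1 - exp (- (real n + 1) * t)) \<partial>\<nu>) =
       (\<integral>\<^sup>+t. ennreal (1 - exp (- (real n + 2) * t)) \<partial>\<nu>)"
    proof (rule nn_integral_cong_AE)
      show "AE t in \<nu>. ennreal (exp (- t) ^ n * w t) + ennreal (1 - exp (- (real n + 1) * t)) =
         ennreal (1 - exp (- (real n + 2) * t))"
        using that(2)
      proof eventually_elim
        case (elim t)
        have "exp (- t) ^ n * w t + (1 - exp (- (real n + 1) * t)) = 1 - exp (- (real n + 2) * t)"
          by (simp add: w_def exp_of_nat_mult[symmetric] right_diff_distrib exp_add[symmetric] algebra_simps)
        moreover have "0 \<le> exp (- t) ^ n * w t"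
          using w_pos[OF elim] by simp
        moreover have "0 \<le> (real n + 1) * t"
          using elim by (intro mult_nonneg_nonneg) auto
        hence "exp (- ((real n + 1) * t)) \<le> exp 0"
          by (subst exp_le_cancel_iff) linarith
        hence "0 \<le> 1 - exp (- (real n + 1) * t)"
          by (simp only: exp_zero mult_minus_left diff_ge_0_iff_ge)
        ultimately show ?case
          by (simp only: ennreal_plus[symmetric])
      qed
    qed
  qed auto
  have W_eq: "(\<integral>\<^sup>+t. ennreal (exp (- t) ^ n * w t) \<partial>\<nu>1) = (\<integral>\<^sup>+t. ennreal (exp (- t) ^ n * w t) \<partial>\<nu>2)" for n
  proof -
    let ?F = "\<lambda>\<nu> l. \<integral>\<^sup>+t. ennreal (1 - exp (- l * t)) \<partial>\<nu>"
    let ?W = "\<lambda>\<nu>. \<integral>\<^sup>+t. ennreal (exp (- t) ^ n * w t) \<partial>\<nu>"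
    have n: "real n + 1 > 0" "real n + 2 > 0" by auto
    have "?F \<nu>1 (real n + 1) + ?W \<nu>1 = ?F \<nu>1 (real n + 2)"
      by (subst add.commute) (rule w_split[OF sets(1) pos(1)])
    also have "\<dots> = ?F \<nu>2 (real n + 2)" by (rule eq[OF n(2)])
    also have "\<dots> = ?F \<nu>2 (real n + 1) + ?W \<nu>2"
      by (subst add.commute) (rule w_split[OF sets(2) pos(2), symmetric])
    also have "?F \<nu>2 (real n + 1) = ?F \<nu>1 (real n + 1)" by (rule eq[OF n(1), symmetric])
    \<comment> \<open>The common summand may be cancelled in the extended nonnegative reals because
      \<open>fin\<close> makes it finite.\<close>
    finally show ?thesis
      using fin[OF n(1)] by (auto simp only: ennreal_add_left_cancel infinity_ennreal_def less_irrefl)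
  qed
  define c where "c = (\<integral>\<^sup>+t. ennreal (w t) \<partial>\<nu>1)"
  have c: "c = (\<integral>\<^sup>+t. ennreal (w t) \<partial>\<nu>1)" "c = (\<integral>\<^sup>+t. ennreal (w t) \<partial>\<nu>2)"
    using W_eq[of 0] by (simp_all add: c_def)
  have "c \<noteq> \<infinity>"
    using w_split[OF sets(1) pos(1), of 0] fin[of 2] by (auto simp: c_def)
  show ?thesis
  proof (cases "c = 0")
    \<comment> \<open>Without mass there is nothing to normalise; positivity of \<open>w\<close>
      then makes both measures zero.\<close>
    case True
    have "emeasure \<nu> A = 0" if [measurable_cong]: "sets \<nu> = sets borel" and "AE t in \<nu>. t > 0"
      and "c = (\<integral>\<^sup>+t. ennreal (w t) \<partial>\<nu>)" for \<nu> A
    proof -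
      have "AE t in \<nu>. ennreal (w t) = 0"
        using that True by (subst nn_integral_0_iff_AE[symmetric]) auto
      with that(2) have "AE t in \<nu>. False"
      proof eventually_elim
        case (elim t)
        thus ?case using w_pos[of t] by (simp add: ennreal_eq_0_iff)
      qed
      hence "space \<nu> \<in> null_sets \<nu>" by (simp add: AE_iff_null)
      hence "emeasure \<nu> (space \<nu>) = 0" by auto
      thus ?thesis using emeasure_space[of \<nu> A] by simp
    qed
    from this[OF sets(1) pos(1) c(1)] this[OF sets(2) pos(2) c(2)] show ?thesis
      by (intro measure_eqI) (simp_all add: sets)
  next
    case False
    define \<rho> where "\<rho> \<nu> = density \<nu> (\<lambda>t. ennreal (w t) / c)" for \<nu>
    define D where "D \<nu> = distr (\<rho> \<nu>) borel (\<lambda>t. exp (- t))" for \<nu>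
    have rd: "real_distribution (D \<nu>)" "AE x in D \<nu>. x \<in> {0..1}"
      and mom: "(\<integral>x. x ^ n \<partial>D \<nu>) = enn2real ((\<integral>\<^sup>+t. ennreal (exp (- t) ^ n * w t) \<partial>\<nu>) / c)"
      and repr: "A \<in> sets borel \<Longrightarrow>
         emeasure \<nu> A = (\<integral>\<^sup>+x. indicator A (- ln x) * (c / ennreal (w (- ln x))) \<partial>D \<nu>)"
      if [measurable_cong]: "sets \<nu> = sets borel" and pos: "AE t in \<nu>. t > 0"
        and c: "c = (\<integral>\<^sup>+t. ennreal (w t) \<partial>\<nu>)" for \<nu> n A
    proof -
      have [measurable_cong]: "sets (\<rho> \<nu>) = sets borel" by (simp add: \<rho>_def that)
      have "prob_space (\<rho> \<nu>)"
        using \<open>c \<noteq> \<infinity>\<close> False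
        by (intro prob_spaceI)
           (auto simp: \<rho>_def emeasure_density nn_integral_divide c[symmetric] ennreal_divide_self less_top cong: nn_integral_cong)
      then interpret prob_space "\<rho> \<nu>" .
      show "real_distribution (D \<nu>)"
        unfolding D_def real_distribution_def real_distribution_axioms_def
        by (auto intro!: prob_space_distr)
      have "AE t in \<rho> \<nu>. t > 0"
        using pos unfolding \<rho>_def by (subst AE_density) (auto elim: eventually_mono)
      thus "AE x in D \<nu>. x \<in> {0..1}"
        unfolding D_def by (subst AE_distr_iff) auto
      have "(\<integral>x. x ^ n \<partial>D \<nu>) = (\<integral>t. exp (- t) ^ n \<partial>\<rho> \<nu>)"
        unfolding D_def by (subst integral_distr) auto
      also have "\<dots> = enn2real (\<integral>\<^sup>+t. ennreal (exp (- t) ^ n) \<partial>\<rho> \<nu>)"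
        by (subst integral_eq_nn_integral) auto
      also have "(\<integral>\<^sup>+t. ennreal (exp (- t) ^ n) \<partial>\<rho> \<nu>) = (\<integral>\<^sup>+t. ennreal (exp (- t) ^ n * w t) / c \<partial>\<nu>)"
        unfolding \<rho>_def
        by (subst nn_integral_density) 
           (auto intro!: nn_integral_cong simp: ennreal_mult'' divide_ennreal_def mult_ac)
      also have "\<dots> = (\<integral>\<^sup>+t. ennreal (exp (- t) ^ n * w t) \<partial>\<nu>) / c"
        by (rule nn_integral_divide) auto
      finally show "(\<integral>x. x ^ n \<partial>D \<nu>) = enn2real ((\<integral>\<^sup>+t. ennreal (exp (- t) ^ n * w t) \<partial>\<nu>) / c)" .
      \<comment> \<open>The original measure is recovered from \<open>D \<nu>\<close> by inverting
        \<open>x = exp (- t)\<close> and dividing out the density \<open>w t / c\<close>, which lies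
        strictly between 0 and infinity for positive \<open>t\<close>.\<close>
      assume [measurable]: "A \<in> sets borel"
      have "(\<integral>\<^sup>+x. indicator A (- ln x) * (c / ennreal (w (- ln x))) \<partial>D \<nu>) =
        (\<integral>\<^sup>+t. indicator A t * (c / ennreal (w t)) \<partial>\<rho> \<nu>)"
        unfolding D_def by (subst nn_integral_distr) auto
      also have "\<dots> = (\<integral>\<^sup>+t. (ennreal (w t) / c) * (indicator A t * (c / ennreal (w t))) \<partial>\<nu>)"
        unfolding \<rho>_def by (subst nn_integral_density) auto
      also have "\<dots> = (\<integral>\<^sup>+t. indicator A t \<partial>\<nu>)"
      proof (rule nn_integral_cong_AE)
        show "AE t in \<nu>. (ennreal (w t) / c) * (indicator A t * (c / ennreal (w t))) = indicator A t"
          using pos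
        proof eventually_elim
          case (elim t)
          obtain c' where c': "c = ennreal c'" "c' > 0"
            using False \<open>c \<noteq> \<infinity>\<close> by (cases c) (auto simp: less_le)
          show ?case
            using w_pos[OF elim] c' by (auto simp: divide_ennreal ennreal_mult[symmetric] split: split_indicator)
        qed
      qed
      also have "\<dots> = emeasure \<nu> A" using that by (intro nn_integral_indicator) simp
      finally show "emeasure \<nu> A = (\<integral>\<^sup>+x. indicator A (- ln x) * (c / ennreal (w (- ln x))) \<partial>D \<nu>)" by simp
    qed
    have "D \<nu>1 = D \<nu>2"
    proof (rule real_distribution_eq_if_moments_eq)
      show "(\<integral>x. x ^ n \<partial>D \<nu>1) = (\<integral>x. x ^ n \<partial>D \<nu>2)" for n
        by (simp only: mom[OF sets(1) pos(1) c(1)] mom[OF sets(2) pos(2) c(2)] W_eq)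
    qed (rule rd[OF sets(1) pos(1) c(1)] rd[OF sets(2) pos(2) c(2)])+
    thus ?thesis
      by (intro measure_eqI)
         (simp_all add: sets repr[OF sets(1) pos(1) c(1)] repr[OF sets(2) pos(2) c(2)])
  qed
qed

subsection \<open>The mixture of tempered stable Levy measures\<close>

lemma borel_measurable_rGamma [measurable]: "(rGamma :: real \<Rightarrow> real) \<in> borel_measurable borel"
  by (intro borel_measurable_continuous_onI continuous_on_rGamma)

lemma has_bochner_integral_Gamma:
  assumes "p > (0::real)"
  shows "has_bochner_integral lborel (\<lambda>s. indicator {0<..} s * (s powr (p - 1) * exp (- s))) (Gamma p)"
proof (rule has_bochner_integral_nn_integral)
  have "(\<integral>\<^sup>+s. ennreal (indicator {0<..} s * (s powr (p - 1) * exp (- s))) \<partial>lborel) =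
    (\<integral>\<^sup>+s. ennreal (indicator {0..} s * s powr (p - 1) / exp s) \<partial>lborel)"
    by (intro nn_integral_cong arg_cong[where f=ennreal]) (auto simp: exp_minus field_simps split: split_indicator)
  thus "(\<integral>\<^sup>+s. ennreal (indicator {0<..} s * (s powr (p - 1) * exp (- s))) \<partial>lborel) = ennreal (Gamma p)"
    using Gamma_conv_nn_integral_real[OF assms] by simp
qed (use assms in auto)

lemma nn_integral_Gamma_scaled:
  assumes "p > (0::real)" "b > 0"
  shows "(\<integral>\<^sup>+t. ennreal (indicator {0<..} t * (t powr (p - 1) * exp (- b * t))) \<partial>lborel) = ennreal (Gamma p * b powr (- p))"
proof -
  have "(\<integral>\<^sup>+t. ennreal (indicator {0<..} t * (t powr (p - 1) * exp (- b * t))) \<partial>lborel) =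
    ennreal \<bar>1 / b\<bar> * (\<integral>\<^sup>+t. ennreal (indicator {0<..} (0 + (1 / b) * t) *
       ((0 + (1 / b) * t) powr (p - 1) * exp (- b * (0 + (1 / b) * t)))) \<partial>lborel)"
    by (rule nn_integral_real_affine) (use assms in auto)
  also have "(\<lambda>t. ennreal (indicator {0<..} (0 + (1 / b) * t) *
       ((0 + (1 / b) * t) powr (p - 1) * exp (- b * (0 + (1 / b) * t))))) =
    (\<lambda>t. ennreal (b powr (1 - p)) * ennreal (indicator {0<..} t * (t powr (p - 1) * exp (- t))))"
  proof
    fix t :: real
    have "(t / b) powr (p - 1) = b powr (1 - p) * t powr (p - 1)" if "t > 0"
      using assms that by (simp add: powr_divide powr_diff field_simps)
    thus "ennreal (indicator {0<..} (0 + (1 / b) * t) *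
       ((0 + (1 / b) * t) powr (p - 1) * exp (- b * (0 + (1 / b) * t)))) =
       ennreal (b powr (1 - p)) * ennreal (indicator {0<..} t * (t powr (p - 1) * exp (- t)))"
      using assms by (auto simp: ennreal_mult'[symmetric] zero_less_mult_iff zero_less_divide_iff split: split_indicator)
  qed
  also have "(\<integral>\<^sup>+t. ennreal (b powr (1 - p)) * ennreal (indicator {0<..} t * (t powr (p - 1) * exp (- t))) \<partial>lborel) =
    ennreal (b powr (1 - p)) * ennreal (Gamma p)"
    using has_bochner_integral_Gamma[OF assms(1)]
    by (subst nn_integral_cmult) (auto simp: has_bochner_integral_iff nn_integral_eq_integral)
  also have "ennreal \<bar>1 / b\<bar> * \<dots> = ennreal (Gamma p * b powr (- p))"
    using assms Gamma_real_pos[OF assms(1)]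
    by (simp add: ennreal_mult'[symmetric] powr_diff powr_minus field_simps)
  finally show ?thesis .
qed

text \<open>Writing \<open>1 - exp (- l * t)\<close> as the integral of
  \<open>t * exp (- a * t)\<close> over \<open>a\<close> in \<open>[0, l]\<close> raises the power
  of \<open>t\<close> to \<open>- x\<close>, which is integrable at 0. After Tonelli the inner
  integral is a Gamma integral with parameter \<open>1 - x\<close> and the outer one that of
  \<open>(1 + a) powr (x - 1)\<close>.\<close>

lemma nn_integral_tempered_stable:
  assumes x: "0 < x" "x < (1::real)" and l: "l > 0"
  shows "(\<integral>\<^sup>+t. ennreal (1 - exp (- l * t)) * ennreal (indicator {0<..} t * (t powr (- 1 - x) * exp (- t))) \<partial>lborel)
     = ennreal (Gamma (1 - x) * (((1 + l) powr x - 1) / x))"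
proof -
  have "(\<integral>\<^sup>+t. ennreal (1 - exp (- l * t)) * ennreal (indicator {0<..} t * (t powr (- 1 - x) * exp (- t))) \<partial>lborel) =
    (\<integral>\<^sup>+t. \<integral>\<^sup>+a. ennreal (indicator {0<..} t * (t powr (- x) * exp (- (1 + a) * t))) * indicator {0..l} a \<partial>lborel \<partial>lborel)"
  proof (rule nn_integral_cong)
    fix t :: real
    show "ennreal (1 - exp (- l * t)) * ennreal (indicator {0<..} t * (t powr (- 1 - x) * exp (- t))) =
      (\<integral>\<^sup>+a. ennreal (indicator {0<..} t * (t powr (- x) * exp (- (1 + a) * t))) * indicator {0..l} a \<partial>lborel)"
    proof (cases "t > 0")
      case True
      let ?F = "\<lambda>a. - (t powr (- 1 - x) * exp (- (1 + a) * t))"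
      have "t powr (- x) = t powr (- 1 - x) * t"
        using True by (simp add: powr_diff powr_minus field_simps)
      hence "(\<integral>\<^sup>+a. ennreal (t powr (- x) * exp (- (1 + a) * t)) * indicator {0..l} a \<partial>lborel) = ennreal (?F l - ?F 0)"
        using l True by (intro nn_integral_FTC_Icc) (auto intro!: derivative_eq_intros)
      also have "?F l - ?F 0 = (1 - exp (- l * t)) * (t powr (- 1 - x) * exp (- t))"
        by (simp add: exp_add[symmetric] algebra_simps)
      finally show ?thesis
        using True l by (simp add: ennreal_mult')
    qed simp
  qed
  also have "\<dots> = (\<integral>\<^sup>+a. \<integral>\<^sup>+t. ennreal (indicator {0<..} t * (t powr (- x) * exp (- (1 + a) * t))) * indicator {0..l} a \<partial>lborel \<partial>lborel)"
    by (rule lborel_pair.Fubini') measurable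
  also have "\<dots> = (\<integral>\<^sup>+a. ennreal (Gamma (1 - x) * (1 + a) powr (x - 1)) * indicator {0..l} a \<partial>lborel)"
  proof (rule nn_integral_cong)
    fix a :: real
    show "(\<integral>\<^sup>+t. ennreal (indicator {0<..} t * (t powr (- x) * exp (- (1 + a) * t))) * indicator {0..l} a \<partial>lborel) =
      ennreal (Gamma (1 - x) * (1 + a) powr (x - 1)) * indicator {0..l} a"
      using nn_integral_Gamma_scaled[of "1 - x" "1 + a"] x by (auto split: split_indicator)
  qed
  also have "\<dots> = ennreal (Gamma (1 - x) * (1 + l) powr x / x - Gamma (1 - x) * (1 + 0) powr x / x)"
    using x l Gamma_real_pos[of "1 - x"]
    by (intro nn_integral_FTC_Icc) (auto intro!: derivative_eq_intros)
  also have "Gamma (1 - x) * (1 + l) powr x / x - Gamma (1 - x) * (1 + 0) powr x / x = Gamma (1 - x) * (((1 + l) powr x - 1) / x)"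
    using x by (simp add: field_simps)
  finally show ?thesis .
qed

section \<open>The mixture measure and its Laplace exponent\<close>

text \<open>The weight \<open>x * rGamma (1 - x)\<close> normalises each component to have exponent
  \<open>(1 + l) powr x - 1\<close>. The reciprocal Gamma function is continuous on the whole line,
  which gives measurability in \<open>x\<close>, and the density is left as an extended nonnegative
  integral, so that Tonelli applies directly.\<close>

definition levy_mixture :: "real measure" where
  "levy_mixture = density lborel (\<lambda>t. \<integral>\<^sup>+x. ennreal (indicator {0<..<1} x * (x * rGamma (1 - x))) *
     ennreal (indicator {0<..} t * (t powr (- 1 - x) * exp (- t))) \<partial>lborel)"

lemma sets_levy_mixture [measurable_cong]: "sets levy_mixture = sets borel"
  by (simp add: levy_mixture_def)

lemma nn_integral_levy_mixture:
  assumes [measurable]: "g \<in> borel_measurable borel"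
  shows "(\<integral>\<^sup>+t. g t \<partial>levy_mixture) =
    (\<integral>\<^sup>+x. ennreal (indicator {0<..<1} x * (x * rGamma (1 - x))) *
       (\<integral>\<^sup>+t. g t * ennreal (indicator {0<..} t * (t powr (- 1 - x) * exp (- t))) \<partial>lborel) \<partial>lborel)"
proof -
  let ?\<kappa> = "\<lambda>x. ennreal (indicator {0<..<1} x * (x * rGamma (1 - x)))"
  let ?k = "\<lambda>x t. ennreal (indicator {0<..} t * (t powr (- 1 - x) * exp (- t)))"
  have "(\<integral>\<^sup>+t. g t \<partial>levy_mixture) = (\<integral>\<^sup>+t. (\<integral>\<^sup>+x. ?\<kappa> x * ?k x t \<partial>lborel) * g t \<partial>lborel)"
    unfolding levy_mixture_def by (subst nn_integral_density) simp_all
  also have "\<dots> = (\<integral>\<^sup>+t. \<integral>\<^sup>+x. ?\<kappa> x * (g t * ?k x t) \<partial>lborel \<partial>lborel)"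
    by (subst nn_integral_multc[symmetric]) (simp_all add: mult_ac)
  also have "\<dots> = (\<integral>\<^sup>+x. \<integral>\<^sup>+t. ?\<kappa> x * (g t * ?k x t) \<partial>lborel \<partial>lborel)"
    by (rule lborel_pair.Fubini') measurable
  also have "\<dots> = (\<integral>\<^sup>+x. ?\<kappa> x * (\<integral>\<^sup>+t. g t * ?k x t \<partial>lborel) \<partial>lborel)"
    by (subst nn_integral_cmult) simp_all
  finally show ?thesis .
qed

lemma AE_levy_mixture_pos: "AE t in levy_mixture. t > 0"
  unfolding levy_mixture_def by (subst AE_density) (auto split: split_indicator_asm)

text \<open>The weight cancels \<open>Gamma (1 - x) / x\<close>, leaving the integral of
  \<open>(1 + l) powr x - 1\<close> over the unit interval, with antiderivative
  \<open>(1 + l) powr x / ln (1 + l) - x\<close>.\<close>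

lemma laplace_levy_mixture:
  assumes l: "l > 0"
  shows "(\<integral>\<^sup>+t. ennreal (1 - exp (- l * t)) \<partial>levy_mixture) = ennreal (phi l)"
proof -
  have "(\<integral>\<^sup>+t. ennreal (1 - exp (- l * t)) \<partial>levy_mixture) =
    (\<integral>\<^sup>+x. ennreal (indicator {0<..<1} x * (x * rGamma (1 - x))) *
       (\<integral>\<^sup>+t. ennreal (1 - exp (- l * t)) * ennreal (indicator {0<..} t * (t powr (- 1 - x) * exp (- t))) \<partial>lborel) \<partial>lborel)"
    by (rule nn_integral_levy_mixture) measurable
  also have "\<dots> = (\<integral>\<^sup>+x. ennreal ((1 + l) powr x - 1) * indicator {0..1} x \<partial>lborel)"
  proof (rule nn_integral_cong_AE)
    show "AE x in lborel. ennreal (indicator {0<..<1} x * (x * rGamma (1 - x))) *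
       (\<integral>\<^sup>+t. ennreal (1 - exp (- l * t)) * ennreal (indicator {0<..} t * (t powr (- 1 - x) * exp (- t))) \<partial>lborel) =
       ennreal ((1 + l) powr x - 1) * indicator {0..1} x"
      \<comment> \<open>The mixture runs over the open interval, the fundamental theorem of calculus
        over the closed one; the two endpoints are null.\<close>
      using AE_lborel_singleton[of 0] AE_lborel_singleton[of 1]
    proof eventually_elim
      case (elim x)
      show ?case
      proof (cases "x \<in> {0<..<1}")
        case True
        have "x * rGamma (1 - x) * (Gamma (1 - x) * (((1 + l) powr x - 1) / x)) = (1 + l) powr x - 1"
        proof -
          have "rGamma (1 - x) * Gamma (1 - x) = 1"
            using Gamma_real_pos[of "1 - x"] True unfolding rGamma_inverse_Gamma by (intro left_inverse) force
          moreover have "x * rGamma (1 - x) * (Gamma (1 - x) * (((1 + l) powr x - 1) / x)) =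
              (rGamma (1 - x) * Gamma (1 - x)) * ((1 + l) powr x - 1)"
            using True by simp
          ultimately show ?thesis by simp
        qed
        moreover have "rGamma (1 - x) \<ge> 0" "x \<ge> 0"
          using True Gamma_real_pos[of "1 - x"] by (simp_all add: rGamma_inverse_Gamma less_imp_le)
        ultimately show ?thesis
          using True nn_integral_tempered_stable[of x l] l
          by (simp only: greaterThanLessThan_iff atLeastAtMost_iff less_imp_le indicator_simps mult_1_left
                mult_1_right simp_thms ennreal_mult'[symmetric] mult_nonneg_nonneg)
      qed (use elim in auto)
    qed
  qed
  also have "\<dots> = ennreal (((1 + l) powr 1 / ln (1 + l) - 1) - ((1 + l) powr 0 / ln (1 + l) - 0))"
    using l by (intro nn_integral_FTC_Icc) (auto intro!: derivative_eq_intros ge_one_powr_ge_zero)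
  also have "((1 + l) powr 1 / ln (1 + l) - 1) - ((1 + l) powr 0 / ln (1 + l) - 0) = phi l"
    using l by (simp add: phi_def field_simps)
  finally show ?thesis .
qed

section \<open>Laplace integrals of the Levy measure and absence of drift\<close>

text \<open>Comparing the two exponents at time 1 gives \<open>phi l = b * l\<close> plus the
  integral. As the integral is nonnegative, \<open>b \<le> phi l / l\<close>, and this bound tends
  to 0 as \<open>l\<close> grows, so the drift vanishes.\<close>

lemma subordinator_laplace:
  assumes lap: "has_laplace_exponent M S phi"
    and lm: "has_subordinator_levy_measure M S \<nu>"
    and l: "l > 0"
  shows "(\<integral>\<^sup>+t. ennreal (1 - exp (- l * t)) \<partial>\<nu>) = ennreal (phi l)"
proof -
  have [measurable_cong]: "sets \<nu> = sets borel" and null: "emeasure \<nu> {..0} = 0"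
    and fin: "(\<integral>\<^sup>+t. ennreal (min 1 t) \<partial>\<nu>) < \<infinity>"
    using lm by (auto simp: has_subordinator_levy_measure_def)
  obtain b where b: "b \<ge> 0" "has_laplace_exponent M S (\<lambda>l. b * l + (\<integral>t. (1 - exp (- l * t)) \<partial>\<nu>))"
    using lm by (auto simp: has_subordinator_levy_measure_def)
  have AE_pos: "AE t in \<nu>. t > 0"
    by (rule AE_I[of _ _ "{..0}"]) (auto simp: null)
  have int: "integrable \<nu> (\<lambda>t. 1 - exp (- l * t))" if "l > 0" for l
  proof (rule integrableI_bounded)
    have "(\<integral>\<^sup>+t. ennreal (norm (1 - exp (- l * t))) \<partial>\<nu>) \<le> (\<integral>\<^sup>+t. ennreal (max 1 l) * ennreal (min 1 t) \<partial>\<nu>)"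
    proof (rule nn_integral_mono_AE)
      show "AE t in \<nu>. ennreal (norm (1 - exp (- l * t))) \<le> ennreal (max 1 l) * ennreal (min 1 t)"
        using AE_pos
      proof eventually_elim
        case (elim t)
        have "1 - exp (- l * t) \<le> l * t" using exp_ge_add_one_self[of "- l * t"] by simp
        also have "\<dots> \<le> max 1 l * t" using elim by (intro mult_right_mono) auto
        finally have 1: "1 - exp (- l * t) \<le> max 1 l * t" .
        have 2: "1 - exp (- l * t) \<le> max 1 l" by (rule order.trans[of _ 1]) auto
        have "1 - exp (- l * t) \<le> max 1 l * min 1 t"
          using 1 2 by (cases "1 \<le> t") (simp_all only: min_def if_True if_False mult_1_right)
        moreover have "1 - exp (- l * t) \<ge> 0" using elim that by simp
        ultimately show ?case
          using elim by (subst ennreal_mult'[symmetric]) (auto intro!: ennreal_leI)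
      qed
    qed
    also have "\<dots> = ennreal (max 1 l) * (\<integral>\<^sup>+t. ennreal (min 1 t) \<partial>\<nu>)"
      by (rule nn_integral_cmult) measurable
    also have "\<dots> < \<infinity>" using fin by (simp add: ennreal_mult_less_top)
    finally show "(\<integral>\<^sup>+t. ennreal (norm (1 - exp (- l * t))) \<partial>\<nu>) < \<infinity>" .
  qed measurable
  have nonneg: "AE t in \<nu>. 1 - exp (- l * t) \<ge> 0" if "l > 0" for l
    using AE_pos by eventually_elim (use that in auto)
  have phi_eq: "phi l = b * l + (\<integral>t. (1 - exp (- l * t)) \<partial>\<nu>)" if "l > 0" for l
  proof -
    have "exp (- 1 * phi l) = exp (- 1 * (b * l + (\<integral>t. (1 - exp (- l * t)) \<partial>\<nu>)))"
      using lap b(2) that unfolding has_laplace_exponent_def by (metis zero_le_one)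
    thus ?thesis by simp
  qed
  have "b \<le> 0"
  proof (rule tendsto_lowerbound)
    show "((\<lambda>l::real. 1 / ln (1 + l) - 1 / l) \<longlongrightarrow> 0) at_top" by real_asymp
    show "eventually (\<lambda>l. b \<le> 1 / ln (1 + l) - 1 / l) at_top"
      using eventually_gt_at_top[of 0]
    proof eventually_elim
      case (elim l)
      have "b * l \<le> phi l"
        using phi_eq[OF elim] integral_nonneg_AE[OF nonneg[OF elim]] by simp
      hence "b \<le> phi l / l" using elim by (simp add: field_simps)
      also have "\<dots> = 1 / ln (1 + l) - 1 / l" using elim by (simp add: phi_def field_simps)
      finally show ?case .
    qed
  qed simp
  with b(1) have "b = 0" by simp
  thus ?thesis
    using phi_eq[OF l] by (subst nn_integral_eq_integral[OF int[OF l] nonneg[OF l]]) simp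
qed

subsection \<open>The kernel of the mixture near the origin\<close>

text \<open>For \<open>e > 0\<close> this is \<open>2 * e powr (p / 2)\<close> times the modified
  Bessel function of the second kind of order \<open>p\<close> at \<open>2 * sqrt e\<close>; for
  \<open>e = 0\<close> and \<open>p > 0\<close> it is \<open>Gamma p\<close>.\<close>

definition bessel_integral :: "real \<Rightarrow> real \<Rightarrow> real" where
  "bessel_integral p e = (\<integral>s. indicator {0<..} s * (s powr (p - 1) * exp (- s - e / s)) \<partial>lborel)"

lemma borel_measurable_bessel_integral [measurable]: "(\<lambda>p. bessel_integral p e) \<in> borel_measurable borel"
  unfolding bessel_integral_def by measurable

lemma bessel_integral_nonneg: "0 \<le> bessel_integral p e"
  unfolding bessel_integral_def by (intro integral_nonneg_AE) auto

lemma integrable_bessel_integral: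
  fixes p e :: real
  assumes "p > 0" "e \<ge> 0"
  shows "integrable lborel (\<lambda>s. indicator {0<..} s * (s powr (p - 1) * exp (- s - e / s)))"
proof (rule Bochner_Integration.integrable_bound)
  show "integrable lborel (\<lambda>s. indicator {0<..} s * (s powr (p - 1) * exp (- s)))"
    using has_bochner_integral_Gamma[OF assms(1)] by (simp add: has_bochner_integral_iff)
qed (use assms in \<open>auto split: split_indicator intro!: AE_I2 mult_left_mono\<close>)

text \<open>The inversion \<open>t = e / s\<close>.\<close>

lemma nn_integral_inversion:
  fixes p e :: real
  assumes p: "p > 0" and e: "e > 0"
  shows "(\<integral>\<^sup>+t. ennreal (indicator {0<..} t * (t powr (- p - 1) * exp (- t - e / t))) \<partial>lborel) =
     ennreal (e powr (- p) * bessel_integral p e)"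
proof -
  define f where "f t = t powr (- p - 1) * exp (- t - e / t)" for t
  define h where "h s = e powr (- p) * (s powr (p - 1) * exp (- s - e / s))" for s
  have subst: "\<bar>- e / s\<^sup>2\<bar> * f (e / s) = h s" if "s \<in> {0<..}" for s
  proof -
    have s: "s > 0" using that by simp
    have "(e / s) powr (- p - 1) = e powr (- p) * s powr (p - 1) * (s\<^sup>2 / e)"
    proof -
      have "(e / s) powr (- p - 1) = e powr (- p - 1) * s powr (p + 1)"
        using s e by (simp add: powr_divide powr_minus_divide[of s] powr_diff powr_add powr_minus field_simps)
      moreover have "e powr (- p - 1) = e powr (- p) / e"
        using e by (simp add: powr_diff)
      moreover have "s powr (p + 1) = s powr (p - 1) * s\<^sup>2"
        using s by (simp add: powr_add powr_diff power2_eq_square)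
      ultimately show ?thesis by simp
    qed
    thus ?thesis
      using s e by (simp add: f_def h_def)
  qed
  have int_h: "integrable lborel (\<lambda>s. indicator {0<..} s *\<^sub>R h s)"
    using integrable_mult_right[OF integrable_bessel_integral[OF p, of e], of "e powr (- p)"] e
    by (simp add: h_def mult_ac)
  \<comment> \<open>The substitution rule used below speaks of absolute integrability with respect
    to the completed Lebesgue measure; passing to the completion changes neither integrability nor
    the integral.\<close>
  hence ai_h: "h absolutely_integrable_on {0<..}"
    unfolding set_integrable_def by (subst integrable_completion) auto
  have val_h: "integral {0<..} h = e powr (- p) * bessel_integral p e"
  proof -
    have "integral {0<..} h = (LINT s:{0<..}|lebesgue. h s)"
      using set_lebesgue_integral_eq_integral(2)[OF ai_h] by simp
    also have "\<dots> = (\<integral>s. indicator {0<..} s *\<^sub>R h s \<partial>lborel)"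
      unfolding set_lebesgue_integral_def using int_h by (intro integral_completion) auto
    also have "\<dots> = e powr (- p) * bessel_integral p e"
      unfolding bessel_integral_def h_def
      by (subst integral_mult_right_zero[symmetric]) (simp add: mult_ac)
    finally show ?thesis .
  qed
  have img: "(\<lambda>s. e / s) ` {0<..} = {0<..}"
  proof (intro equalityI subsetI)
    fix t :: real assume "t \<in> {0<..}"
    thus "t \<in> (\<lambda>s. e / s) ` {0<..}"
      using e by (intro image_eqI[of _ _ "e / t"]) auto
  qed (use e in auto)
  \<comment> \<open>The rule is an equivalence, so integrability and value of the transformed
    integrand \<open>h\<close>, both already known, transfer back to \<open>f\<close>.\<close>
  have "(\<lambda>s. \<bar>- e / s\<^sup>2\<bar> * f (e / s)) absolutely_integrable_on {0<..} \<and>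
      integral {0<..} (\<lambda>s. \<bar>- e / s\<^sup>2\<bar> * f (e / s)) = e powr (- p) * bessel_integral p e \<longleftrightarrow>
      f absolutely_integrable_on ((\<lambda>s. e / s) ` {0<..}) \<and>
      integral ((\<lambda>s. e / s) ` {0<..}) f = e powr (- p) * bessel_integral p e"
    by (rule has_absolute_integral_change_of_variables_1')
       (use e in \<open>auto intro!: derivative_eq_intros inj_onI simp: power2_eq_square\<close>)
  moreover have "(\<lambda>s. \<bar>- e / s\<^sup>2\<bar> * f (e / s)) absolutely_integrable_on {0<..}"
  proof -
    have "(\<lambda>s. indicator {0<..} s *\<^sub>R (\<bar>- e / s\<^sup>2\<bar> * f (e / s))) = (\<lambda>s. indicator {0<..} s *\<^sub>R h s)"
    proof
      fix s :: real
      show "indicator {0<..} s *\<^sub>R (\<bar>- e / s\<^sup>2\<bar> * f (e / s)) = indicator {0<..} s *\<^sub>R h s"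
        by (cases "s \<in> {0<..}") (simp_all only: subst indicator_simps scaleR_zero_left not_False_eq_True)
    qed
    thus ?thesis
      using ai_h unfolding set_integrable_def by (simp only:)
  qed
  moreover have "integral {0<..} (\<lambda>s. \<bar>- e / s\<^sup>2\<bar> * f (e / s)) = integral {0<..} h"
    by (rule integral_cong) (rule subst)
  ultimately have "f absolutely_integrable_on {0<..}" "integral {0<..} f = e powr (- p) * bessel_integral p e"
    by (simp_all add: img val_h)
  hence "(f has_integral e powr (- p) * bessel_integral p e) {0<..}"
    using set_lebesgue_integral_eq_integral(1) by (metis has_integral_integral)
  from nn_integral_has_integral_lebesgue[OF _ this] show ?thesis
    by (simp add: f_def)
qed

text \<open>The integrand obtained from the mixture representation by \<open>x = 1 - u / L\<close> with \<open>e = exp (- L)\<close>.\<close>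

definition mixture_integrand :: "real \<Rightarrow> real \<Rightarrow> real \<Rightarrow> real" where
  "mixture_integrand q L u = indicator {0<..<L} u *
     ((1 - u / L) * (u * exp (- u)) * rGamma (1 + u / L) * bessel_integral (q + 1 - u / L) (exp (- L)))"

lemma borel_measurable_mixture_integrand [measurable]: "mixture_integrand q L \<in> borel_measurable borel"
  unfolding mixture_integrand_def by measurable

section \<open>Bounds uniform in \<open>L\<close> for dominated convergence\<close>

text \<open>For \<open>s \<ge> 1\<close> the larger exponent dominates, for \<open>s < 1\<close> the
  smaller one; the sum covers both cases at once.\<close>

lemma powr_le_add_powr:
  fixes s :: real
  assumes "s > 0" "a \<le> b" "b \<le> c"
  shows "s powr b \<le> s powr a + s powr c"
proof (cases "s \<ge> 1")
  case True
  thus ?thesis using assms powr_mono[of b c s] by (simp add: add_increasing)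
next
  case False
  thus ?thesis using assms powr_mono'[of a b s] by (simp add: add_increasing2)
qed

text \<open>The bound is uniform in \<open>p\<close> and \<open>e\<close>, as required by the moving
  parameters \<open>p = q + 1 - u / L\<close> and \<open>e = exp (- L)\<close>: the factor
  \<open>exp (- e / s)\<close> is at most 1 and the power lies below the sum of its extreme
  cases.\<close>

lemma bessel_integral_bound:
  assumes "q > 0" "q \<le> p" "p \<le> q + 1" "e \<ge> 0"
  shows "bessel_integral p e \<le> Gamma q + Gamma (q + 1)"
proof -
  have g: "has_bochner_integral lborel (\<lambda>s. indicator {0<..} s * (s powr (q - 1) * exp (- s)) +
      indicator {0<..} s * (s powr (q + 1 - 1) * exp (- s))) (Gamma q + Gamma (q + 1))"
    using assms by (intro has_bochner_integral_add has_bochner_integral_Gamma) auto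
  have "bessel_integral p e \<le> (\<integral>s. indicator {0<..} s * (s powr (q - 1) * exp (- s)) +
      indicator {0<..} s * (s powr (q + 1 - 1) * exp (- s)) \<partial>lborel)"
    unfolding bessel_integral_def
  proof (intro integral_mono integrable_bessel_integral)
    fix s :: real
    have "s powr (p - 1) * exp (- s - e / s) \<le> (s powr (q - 1) + s powr (q + 1 - 1)) * exp (- s)" if "s > 0"
      using assms that by (intro mult_mono powr_le_add_powr) auto
    thus "indicator {0<..} s * (s powr (p - 1) * exp (- s - e / s)) \<le>
      indicator {0<..} s * (s powr (q - 1) * exp (- s)) + indicator {0<..} s * (s powr (q + 1 - 1) * exp (- s))"
      by (auto split: split_indicator simp: algebra_simps)
  qed (use assms g in \<open>auto simp: has_bochner_integral_iff\<close>)
  thus ?thesis using g by (simp add: has_bochner_integral_iff)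
qed

text \<open>For \<open>0 < u < L\<close> the argument \<open>1 + u / L\<close> stays in the compact
  interval \<open>[1, 2]\<close>, where \<open>rGamma\<close> is bounded, and
  \<open>q + 1 - u / L\<close> stays in \<open>[q, q + 1]\<close>. What remains is
  \<open>u * exp (- u)\<close>, written as the Gamma integrand with parameter 2.\<close>

lemma mixture_integrand_bound:
  assumes q: "q > 0"
  obtains C where "\<And>L u. L > 0 \<Longrightarrow>
     norm (mixture_integrand q L u) \<le> C * (indicator {0<..} u * (u powr (2 - 1) * exp (- u)))"
proof -
  have "compact (rGamma ` {1..2::real})"
    by (intro compact_continuous_image continuous_on_rGamma) auto
  then obtain B where B: "\<And>y. y \<in> {1..2::real} \<Longrightarrow> norm (rGamma y) \<le> B"
    by (metis bounded_iff compact_imp_bounded imageI)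
  show ?thesis
  proof (rule that)
    fix L u :: real assume L: "L > 0"
    show "norm (mixture_integrand q L u) \<le> (B * (Gamma q + Gamma (q + 1))) * (indicator {0<..} u * (u powr (2 - 1) * exp (- u)))"
    proof (cases "u \<in> {0<..<L}")
      case True
      hence y: "0 < u / L" "u / L < 1" using L by auto
      let ?K = "bessel_integral (q + 1 - u / L) (exp (- L))"
      have "norm (mixture_integrand q L u) = ((1 - u / L) * (u * exp (- u))) * (norm (rGamma (1 + u / L)) * ?K)"
        using True y by (simp add: mixture_integrand_def abs_mult bessel_integral_nonneg)
      also have "\<dots> \<le> (1 * (u * exp (- u))) * (B * (Gamma q + Gamma (q + 1)))"
        using True y q B[of "1 + u / L"] order.trans[OF norm_ge_zero B[of 1]]
        by (intro mult_mono bessel_integral_bound mult_nonneg_nonneg bessel_integral_nonneg) auto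
      finally show ?thesis using True by (simp add: mult_ac)
    next
      case False
      have "0 \<le> B * (Gamma q + Gamma (q + 1))"
        using q order.trans[OF norm_ge_zero B[of 1]] by (intro mult_nonneg_nonneg add_nonneg_nonneg) auto
      thus ?thesis using False by (simp add: mixture_integrand_def)
    qed
  qed
qed

lemma integrable_mixture_integrand:
  assumes "q > 0" "L > 0"
  shows "integrable lborel (mixture_integrand q L)"
proof -
  obtain C where C: "\<And>L u. L > 0 \<Longrightarrow>
     norm (mixture_integrand q L u) \<le> C * (indicator {0<..} u * (u powr (2 - 1) * exp (- u)))"
    using mixture_integrand_bound[OF assms(1)] by blast
  show ?thesis
  proof (rule Bochner_Integration.integrable_bound)
    show "integrable lborel (\<lambda>u. C * (indicator {0<..} u * (u powr (2 - 1) * exp (- u))))"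
      using has_bochner_integral_Gamma[of 2] by (simp add: has_bochner_integral_iff)
    show "AE u in lborel. norm (mixture_integrand q L u) \<le> norm (C * (indicator {0<..} u * (u powr (2 - 1) * exp (- u))))"
      using order.trans[OF C[OF assms(2)] abs_ge_self] by (intro AE_I2) simp
  qed measurable
qed

text \<open>Each component contributes a Bessel-type integral by inversion, with prefactor
  \<open>e powr (- (q + x))\<close>. For small \<open>e\<close> this concentrates at
  \<open>x = 1\<close>, which is why \<open>x = 1 - u / L\<close> is the right scale.\<close>

lemma nn_integral_heat_levy_mixture:
  assumes q: "q > 0" and L: "L > 0"
  shows "(\<integral>\<^sup>+t. ennreal (t powr (- q) * exp (- exp (- L) / t)) \<partial>levy_mixture) =
     ennreal (exp ((q + 1) * L) / L\<^sup>2 * (\<integral>u. mixture_integrand q L u \<partial>lborel))"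
proof -
  define e where "e = exp (- L)"
  have e: "e > 0" by (simp add: e_def)
  define F where "F x = indicator {0<..<1} x * (x * rGamma (1 - x)) * (e powr (- (q + x)) * bessel_integral (q + x) e)" for x
  have [measurable]: "F \<in> borel_measurable borel" unfolding F_def by measurable
  have rG: "0 \<le> rGamma (1 - x)" if "x < 1" for x :: real
    using that Gamma_real_pos[of "1 - x"] by (simp add: rGamma_inverse_Gamma less_imp_le)
  have "(\<integral>\<^sup>+t. ennreal (t powr (- q) * exp (- e / t)) \<partial>levy_mixture) =
    (\<integral>\<^sup>+x. ennreal (indicator {0<..<1} x * (x * rGamma (1 - x))) *
       (\<integral>\<^sup>+t. ennreal (t powr (- q) * exp (- e / t)) * ennreal (indicator {0<..} t * (t powr (- 1 - x) * exp (- t))) \<partial>lborel) \<partial>lborel)"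
    by (rule nn_integral_levy_mixture) measurable
  also have "\<dots> = (\<integral>\<^sup>+x. ennreal (F x) \<partial>lborel)"
  proof (rule nn_integral_cong)
    fix x :: real
    have "(\<integral>\<^sup>+t. ennreal (t powr (- q) * exp (- e / t)) * ennreal (indicator {0<..} t * (t powr (- 1 - x) * exp (- t))) \<partial>lborel) =
      ennreal (e powr (- (q + x)) * bessel_integral (q + x) e)" if "x > 0"
    proof -
      have "(\<integral>\<^sup>+t. ennreal (t powr (- q) * exp (- e / t)) * ennreal (indicator {0<..} t * (t powr (- 1 - x) * exp (- t))) \<partial>lborel) =
        (\<integral>\<^sup>+t. ennreal (indicator {0<..} t * (t powr (- (q + x) - 1) * exp (- t - e / t))) \<partial>lborel)"
      proof (rule nn_integral_cong)
        fix t :: real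
        have "- (q + x) - 1 = - q + (- 1 - x)" by simp
        hence "t powr (- (q + x) - 1) = t powr (- q) * t powr (- 1 - x)"
          by (simp only: powr_add)
        thus "ennreal (t powr (- q) * exp (- e / t)) * ennreal (indicator {0<..} t * (t powr (- 1 - x) * exp (- t))) =
          ennreal (indicator {0<..} t * (t powr (- (q + x) - 1) * exp (- t - e / t)))"
          by (subst ennreal_mult'[symmetric]) (simp_all add: exp_diff exp_minus field_simps split: split_indicator)
      qed
      thus ?thesis using nn_integral_inversion[of "q + x" e] q e that by simp
    qed
    thus "ennreal (indicator {0<..<1} x * (x * rGamma (1 - x))) *
       (\<integral>\<^sup>+t. ennreal (t powr (- q) * exp (- e / t)) * ennreal (indicator {0<..} t * (t powr (- 1 - x) * exp (- t))) \<partial>lborel) =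
       ennreal (F x)"
      using rG[of x] by (cases "x \<in> {0<..<1}") (auto simp: F_def ennreal_mult'[symmetric])
  qed
  also have "\<dots> = ennreal \<bar>- 1 / L\<bar> * (\<integral>\<^sup>+u. ennreal (F (1 + (- 1 / L) * u)) \<partial>lborel)"
    by (rule nn_integral_real_affine) (use L in auto)
  also have "(\<lambda>u. F (1 + (- 1 / L) * u)) = (\<lambda>u. (exp ((q + 1) * L) / L) * mixture_integrand q L u)"
  proof
    fix u
    have x: "1 + (- 1 / L) * u = 1 - u / L" by simp
    show "F (1 + (- 1 / L) * u) = (exp ((q + 1) * L) / L) * mixture_integrand q L u"
    proof (cases "u \<in> {0<..<L}")
      case True
      hence y: "0 < u / L" "u / L < 1" using L by auto
      \<comment> \<open>Because \<open>e = exp (- L)\<close>, the factor \<open>L\<close> cancels in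
        \<open>u / L\<close> and leaves the decay \<open>exp (- u)\<close>.\<close>
      have "e powr (- (q + (1 - u / L))) = exp ((q + 1) * L) * exp (- u)"
        using L by (simp add: e_def powr_def exp_add[symmetric] field_simps)
      \<comment> \<open>The zero of \<open>rGamma\<close> at 0 is split off by the functional
        equation. It supplies the factor \<open>u\<close> and one power of \<open>1 / L\<close>; the
        other comes from the substitution.\<close>
      moreover have "rGamma (u / L) = u / L * rGamma (1 + u / L)"
        using rGamma_plus1[of "u / L"] by (simp add: add.commute)
      ultimately show ?thesis
        unfolding x F_def mixture_integrand_def using True y by (simp add: e_def add_diff_eq)
    next
      case False
      hence "1 - u / L \<notin> {0<..<1}" using L by (auto simp: zero_less_divide_iff)
      thus ?thesis using False unfolding x F_def mixture_integrand_def by simp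
    qed
  qed
  also have "(\<integral>\<^sup>+u. ennreal ((exp ((q + 1) * L) / L) * mixture_integrand q L u) \<partial>lborel) =
      ennreal ((exp ((q + 1) * L) / L) * (\<integral>u. mixture_integrand q L u \<partial>lborel))"
  proof (subst nn_integral_eq_integral)
    have "0 \<le> mixture_integrand q L u" for u
    proof (cases "u \<in> {0<..<L}")
      case True
      hence y: "0 < u / L" "u / L < 1" using L by auto
      thus ?thesis
        unfolding mixture_integrand_def using True rG[of "- (u / L)"]
        by (intro mult_nonneg_nonneg bessel_integral_nonneg) auto
    qed (simp add: mixture_integrand_def)
    thus "AE u in lborel. 0 \<le> (exp ((q + 1) * L) / L) * mixture_integrand q L u"
      using L by auto
  qed (use integrable_mixture_integrand[OF q L] in auto)
  also have "ennreal \<bar>- 1 / L\<bar> * \<dots> = ennreal (exp ((q + 1) * L) / L\<^sup>2 * (\<integral>u. mixture_integrand q L u \<partial>lborel))"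
    using L by (subst ennreal_mult'[symmetric]) (simp_all add: power2_eq_square)
  finally show ?thesis by (simp add: e_def)
qed

section \<open>Limits as \<open>L\<close> tends to infinity\<close>

text \<open>Dominated convergence in \<open>s\<close>: the power tends to \<open>q\<close> and the
  singular term \<open>exp (- L) / s\<close> to 0. Once \<open>L > u\<close> the power stays between
  \<open>q - 1\<close> and \<open>q\<close>, so two Gamma integrands dominate.\<close>

lemma bessel_integral_tendsto:
  assumes q: "q > 0" and u: "u > 0"
  shows "((\<lambda>L. bessel_integral (q + 1 - u / L) (exp (- L))) \<longlongrightarrow> Gamma (q + 1)) at_top"
proof -
  let ?w = "\<lambda>s. indicator {0<..} s * (s powr (q - 1) * exp (- s)) + indicator {0<..} s * (s powr (q + 1 - 1) * exp (- s))"
  have "((\<lambda>L. \<integral>s. indicator {0<..} s * (s powr (q + 1 - u / L - 1) * exp (- s - exp (- L) / s)) \<partial>lborel) \<longlongrightarrow>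
    (\<integral>s. indicator {0<..} s * (s powr (q + 1 - 1) * exp (- s)) \<partial>lborel)) at_top"
  proof (rule integral_dominated_convergence_at_top[where w = ?w])
    show "integrable lborel ?w"
      using q has_bochner_integral_Gamma[of q] has_bochner_integral_Gamma[of "q + 1"]
      by (intro Bochner_Integration.integrable_add) (auto simp: has_bochner_integral_iff)
    show "AE s in lborel. ((\<lambda>L. indicator {0<..} s * (s powr (q + 1 - u / L - 1) * exp (- s - exp (- L) / s))) \<longlongrightarrow>
      indicator {0<..} s * (s powr (q + 1 - 1) * exp (- s))) at_top"
    proof (intro AE_I2)
      fix s :: real
      have "((\<lambda>L. s powr (q + 1 - u / L - 1) * exp (- s - exp (- L) / s)) \<longlongrightarrow>
        s powr (q + 1 - 0 - 1) * exp (- s - 0 / s)) at_top" if "s > 0"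
      proof -
        have 1: "((\<lambda>L. u / L) \<longlongrightarrow> 0) at_top" by real_asymp
        have 2: "((\<lambda>L::real. exp (- L)) \<longlongrightarrow> 0) at_top" by real_asymp
        show ?thesis
          by (intro tendsto_intros 1 2) (use that in auto)
      qed
      thus "((\<lambda>L. indicator {0<..} s * (s powr (q + 1 - u / L - 1) * exp (- s - exp (- L) / s))) \<longlongrightarrow>
        indicator {0<..} s * (s powr (q + 1 - 1) * exp (- s))) at_top"
        by (cases "s > 0") auto
    qed
    show "eventually (\<lambda>L. AE s in lborel. norm (indicator {0<..} s * (s powr (q + 1 - u / L - 1) * exp (- s - exp (- L) / s))) \<le> ?w s) at_top"
      using eventually_gt_at_top[of u]
    proof eventually_elim
      case (elim L)
      hence y: "0 < u / L" "u / L < 1" using u by auto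
      show ?case
      proof (intro AE_I2)
        fix s :: real
        have "s powr (q + 1 - u / L - 1) * exp (- s - exp (- L) / s) \<le> (s powr (q - 1) + s powr (q + 1 - 1)) * exp (- s)" if "s > 0"
          using y that by (intro mult_mono powr_le_add_powr) auto
        thus "norm (indicator {0<..} s * (s powr (q + 1 - u / L - 1) * exp (- s - exp (- L) / s))) \<le> ?w s"
          by (auto split: split_indicator simp: algebra_simps)
      qed
    qed
  qed measurable
  thus ?thesis
    using has_bochner_integral_Gamma[of "q + 1"] q unfolding bessel_integral_def by (simp add: has_bochner_integral_iff)
qed

text \<open>For fixed \<open>u\<close> the cut-off \<open>u < L\<close> eventually holds, and the
  integrand tends to \<open>Gamma (q + 1) * u * exp (- u)\<close> for \<open>u > 0\<close>. The
  remaining integral is \<open>Gamma 2 = 1\<close>.\<close>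

lemma integral_mixture_integrand_tendsto:
  assumes q: "q > 0"
  shows "((\<lambda>L. \<integral>u. mixture_integrand q L u \<partial>lborel) \<longlongrightarrow> Gamma (q + 1)) at_top"
proof -
  obtain C where C: "\<And>L u. L > 0 \<Longrightarrow>
     norm (mixture_integrand q L u) \<le> C * (indicator {0<..} u * (u powr (2 - 1) * exp (- u)))"
    using mixture_integrand_bound[OF q] by blast
  let ?w = "\<lambda>u. indicator {0<..} u * (u powr (2 - 1) * exp (- u)) :: real"
  have w: "has_bochner_integral lborel ?w 1"
    using has_bochner_integral_Gamma[of 2] by (simp add: Gamma_numeral)
  have "((\<lambda>L. \<integral>u. mixture_integrand q L u \<partial>lborel) \<longlongrightarrow> (\<integral>u. Gamma (q + 1) * ?w u \<partial>lborel)) at_top"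
  proof (rule integral_dominated_convergence_at_top[where w = "\<lambda>u. C * ?w u"])
    show "integrable lborel (\<lambda>u. C * ?w u)"
      using w by (simp add: has_bochner_integral_iff)
    show "eventually (\<lambda>L. AE u in lborel. norm (mixture_integrand q L u) \<le> C * ?w u) at_top"
      using eventually_gt_at_top[of 0] by eventually_elim (use C in auto)
    show "AE u in lborel. ((\<lambda>L. mixture_integrand q L u) \<longlongrightarrow> Gamma (q + 1) * ?w u) at_top"
    proof (intro AE_I2)
      fix u :: real
      show "((\<lambda>L. mixture_integrand q L u) \<longlongrightarrow> Gamma (q + 1) * ?w u) at_top"
      proof (cases "u > 0")
        case True
        have 1: "((\<lambda>L. u / L) \<longlongrightarrow> 0) at_top" by real_asymp
        have "isCont rGamma (1 + 0 :: real)"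
          using continuous_on_rGamma[of "UNIV :: real set"] by (simp add: continuous_on_eq_continuous_at)
        hence 2: "((\<lambda>L. rGamma (1 + u / L)) \<longlongrightarrow> rGamma (1 + 0)) at_top"
          by (rule isCont_tendsto_compose) (intro tendsto_intros 1)
        have "((\<lambda>L. (1 - u / L) * (u * exp (- u)) * rGamma (1 + u / L) * bessel_integral (q + 1 - u / L) (exp (- L)))
          \<longlongrightarrow> (1 - 0) * (u * exp (- u)) * rGamma (1 + 0) * Gamma (q + 1)) at_top"
          by (intro tendsto_mult tendsto_diff tendsto_const 1 2 bessel_integral_tendsto q True)
        also have "?this \<longleftrightarrow> ((\<lambda>L. mixture_integrand q L u) \<longlongrightarrow> (1 - 0) * (u * exp (- u)) * rGamma (1 + 0) * Gamma (q + 1)) at_top"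
        proof (rule tendsto_cong)
          show "eventually (\<lambda>L. (1 - u / L) * (u * exp (- u)) * rGamma (1 + u / L) * bessel_integral (q + 1 - u / L) (exp (- L)) =
            mixture_integrand q L u) at_top"
            using eventually_gt_at_top[of u] by eventually_elim (use True in \<open>auto simp: mixture_integrand_def\<close>)
        qed
        finally show ?thesis using True by (simp add: rGamma_inverse_Gamma mult_ac)
      qed (simp add: mixture_integrand_def)
    qed
  qed measurable
  thus ?thesis using w by (simp add: has_bochner_integral_iff)
qed

subsection \<open>The Levy density of the subordinate process\<close>

lemma nn_integral_levy_density_measure:
  assumes [measurable]: "(\<lambda>t. indicator {0<..} t * \<mu> t) \<in> borel_measurable borel" "g \<in> borel_measurable borel"
  shows "(\<integral>\<^sup>+t. g t \<partial>density lborel (\<lambda>t. ennreal (indicator {0<..} t * \<mu> t))) =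
    (\<integral>\<^sup>+t. ennreal (indicator {0<..} t * \<mu> t) * g t \<partial>lborel)"
  by (rule nn_integral_density) measurable

text \<open>This exhibits the kernel as a functional of the Levy measure alone, so that equal
  measures can be exchanged. If the integral diverges, the Bochner integral and
  \<open>enn2real\<close> both return 0.\<close>

lemma levy_kernel_eq:
  assumes [measurable]: "(\<lambda>t. indicator {0<..} t * \<mu> t) \<in> borel_measurable borel"
    and nonneg: "\<And>t. t > 0 \<Longrightarrow> 0 \<le> \<mu> t"
  shows "levy_kernel d \<mu> r = enn2real (\<integral>\<^sup>+t. ennreal ((4 * pi * t) powr (- real d / 2) * exp (- r\<^sup>2 / (4 * t)))
     \<partial>density lborel (\<lambda>t. ennreal (indicator {0<..} t * \<mu> t)))"
proof -
  let ?g = "\<lambda>t. (4 * pi * t) powr (- real d / 2) * exp (- r\<^sup>2 / (4 * t))"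
  have "levy_kernel d \<mu> r = (\<integral>t. (indicator {0<..} t * \<mu> t) * ?g t \<partial>lborel)"
    unfolding levy_kernel_def set_lebesgue_integral_def
    by (subst integral_mult_right_zero[symmetric], rule Bochner_Integration.integral_cong)
       (auto split: split_indicator simp: powr_mult)
  also have "\<dots> = enn2real (\<integral>\<^sup>+t. ennreal ((indicator {0<..} t * \<mu> t) * ?g t) \<partial>lborel)"
    using nonneg by (intro integral_eq_nn_integral AE_I2) (auto split: split_indicator)
  also have "(\<integral>\<^sup>+t. ennreal ((indicator {0<..} t * \<mu> t) * ?g t) \<partial>lborel) =
     (\<integral>\<^sup>+t. ennreal (indicator {0<..} t * \<mu> t) * ennreal (?g t) \<partial>lborel)"
    by (intro nn_integral_cong ennreal_mult'') auto
  finally show ?thesis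
    by (subst nn_integral_levy_density_measure) simp_all
qed

text \<open>The density is a \<open>\<nu>\<close>-mixture of heat kernels, so the integral of
  \<open>1 - cos (\<xi> \<bullet> y)\<close> becomes the Laplace integral of \<open>\<nu>\<close> at
  \<open>(norm \<xi>)\<^sup>2\<close>. Rotational symmetry removes the imaginary part, hence
  Gaussian part and drift can both be 0.\<close>

lemma has_levy_density_levy_kernel:
  fixes X :: "real \<Rightarrow> 'v \<Rightarrow> 'a::euclidean_space"
  assumes meas [measurable]: "(\<lambda>t. indicator {0<..} t * \<mu> t) \<in> borel_measurable borel"
    and nonneg: "\<And>t. t > 0 \<Longrightarrow> 0 \<le> \<mu> t"
    and \<nu>_def: "\<nu> = density lborel (\<lambda>t. ennreal (indicator {0<..} t * \<mu> t))"
    and fin: "(\<integral>\<^sup>+t. ennreal (min 1 t) \<partial>\<nu>) < \<infinity>"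
    and lap: "\<And>l. l > 0 \<Longrightarrow> (\<integral>\<^sup>+t. ennreal (1 - exp (- l * t)) \<partial>\<nu>) = ennreal (\<psi> l)"
    and \<psi>: "\<psi> 0 = 0" "\<And>l. l > 0 \<Longrightarrow> 0 \<le> \<psi> l"
    and char: "has_characteristic_exponent N X (\<lambda>\<xi>. of_real (\<psi> ((norm \<xi>)\<^sup>2)))"
  shows "has_levy_density N X (\<lambda>y. levy_kernel DIM('a) \<mu> (norm y))"
proof -
  define f :: "'a \<Rightarrow> real" where "f y = levy_kernel DIM('a) \<mu> (norm y)" for y
  \<comment> \<open>Tonelli is carried out with the extended-valued mixture \<open>K\<close>;
    \<open>f\<close> is its real version, with 0 wherever \<open>K\<close> is infinite.\<close>
  define K :: "'a \<Rightarrow> ennreal" where "K y = (\<integral>\<^sup>+t. ennreal (heat_kernel t y) \<partial>\<nu>)" for y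
  have sets_\<nu> [measurable_cong]: "sets \<nu> = sets borel" by (simp add: \<nu>_def)
  have AE_pos: "AE t in \<nu>. t > 0"
    unfolding \<nu>_def by (subst AE_density) (auto split: split_indicator_asm)
  have [measurable]: "(\<lambda>(t, y). heat_kernel t (y::'a)) \<in> borel_measurable (borel \<Otimes>\<^sub>M borel)"
    unfolding heat_kernel_def by measurable
  have K_eq: "K y = (\<integral>\<^sup>+t. ennreal (indicator {0<..} t * \<mu> t) * ennreal (heat_kernel t y) \<partial>lborel)" for y
    unfolding K_def \<nu>_def by (rule nn_integral_levy_density_measure) measurable
  have [measurable]: "K \<in> borel_measurable borel"
    unfolding K_eq[abs_def] by measurable
  have f_K: "f y = enn2real (K y)" for y
    unfolding f_def K_def \<nu>_def heat_kernel_def by (rule levy_kernel_eq[OF meas nonneg])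
  have f_nonneg: "f y \<ge> 0" for y by (simp add: f_K)
  have [measurable]: "f \<in> borel_measurable borel"
    unfolding f_K[abs_def] by measurable
  have f_even: "f (- y) = f y" for y by (simp add: f_def)

  \<comment> \<open>The density of \<open>\<nu>\<close> is treated as a factor under Lebesgue
    measure in \<open>t\<close>, where sigma-finiteness is immediate.\<close>
  have fubini: "(\<integral>\<^sup>+y. g y * K y \<partial>lborel) = (\<integral>\<^sup>+t. \<integral>\<^sup>+y. g y * ennreal (heat_kernel t y) \<partial>lborel \<partial>\<nu>)"
    if [measurable]: "g \<in> borel_measurable borel" for g
  proof -
    have "(\<integral>\<^sup>+y. g y * K y \<partial>lborel) =
      (\<integral>\<^sup>+y. \<integral>\<^sup>+t. g y * (ennreal (indicator {0<..} t * \<mu> t) * ennreal (heat_kernel t y)) \<partial>lborel \<partial>lborel)"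
      unfolding K_eq by (subst nn_integral_cmult) simp_all
    also have "\<dots> = (\<integral>\<^sup>+t. \<integral>\<^sup>+y. g y * (ennreal (indicator {0<..} t * \<mu> t) * ennreal (heat_kernel t y)) \<partial>lborel \<partial>lborel)"
      by (rule lborel_pair.Fubini') measurable
    also have "\<dots> = (\<integral>\<^sup>+t. ennreal (indicator {0<..} t * \<mu> t) * (\<integral>\<^sup>+y. g y * ennreal (heat_kernel t y) \<partial>lborel) \<partial>lborel)"
      by (subst nn_integral_cmult[symmetric]) (simp_all add: mult_ac)
    also have "\<dots> = (\<integral>\<^sup>+t. \<integral>\<^sup>+y. g y * ennreal (heat_kernel t y) \<partial>lborel \<partial>\<nu>)"
      unfolding \<nu>_def by (subst nn_integral_levy_density_measure) simp_all
    finally show ?thesis .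
  qed

  have fin_K: "(\<integral>\<^sup>+y. ennreal (1 - exp (- (norm y)\<^sup>2)) * K y \<partial>lborel) < \<infinity>"
  proof -
    have "(\<integral>\<^sup>+y. ennreal (1 - exp (- (norm y)\<^sup>2)) * K y \<partial>lborel) =
      (\<integral>\<^sup>+t. \<integral>\<^sup>+(y::'a). ennreal (1 - exp (- (norm y)\<^sup>2)) * ennreal (heat_kernel t y) \<partial>lborel \<partial>\<nu>)"
      by (rule fubini) measurable
    also have "\<dots> \<le> (\<integral>\<^sup>+t. ennreal (2 * real DIM('a)) * ennreal (min 1 t) \<partial>\<nu>)"
    proof (rule nn_integral_mono_AE)
      show "AE t in \<nu>. (\<integral>\<^sup>+(y::'a). ennreal (1 - exp (- (norm y)\<^sup>2)) * ennreal (heat_kernel t y) \<partial>lborel) \<le>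
        ennreal (2 * real DIM('a)) * ennreal (min 1 t)"
        using AE_pos
      proof eventually_elim
        case (elim t)
        have "(\<integral>\<^sup>+(y::'a). ennreal (1 - exp (- (norm y)\<^sup>2)) * ennreal (heat_kernel t y) \<partial>lborel) =
          (\<integral>\<^sup>+(y::'a). ennreal (heat_kernel t y * (1 - exp (- (norm y)\<^sup>2))) \<partial>lborel)"
          by (intro nn_integral_cong) (simp add: ennreal_mult'[OF heat_kernel_nonneg] mult.commute)
        also have "\<dots> \<le> ennreal (2 * real DIM('a) * min 1 t)"
          by (rule nn_integral_heat_kernel_bound[OF elim])
        finally show ?case by (simp add: ennreal_mult')
      qed
    qed
    also have "\<dots> = ennreal (2 * real DIM('a)) * (\<integral>\<^sup>+t. ennreal (min 1 t) \<partial>\<nu>)"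
      by (rule nn_integral_cmult) measurable
    also have "\<dots> < \<infinity>" using fin by (simp add: ennreal_mult_less_top)
    finally show ?thesis .
  qed
  have f_AE: "AE y in lborel. ennreal (f y) = K y"
  proof -
    \<comment> \<open>A finite integral forces an almost everywhere finite integrand, and the factor
      \<open>1 - exp (- (norm y)\<^sup>2)\<close> is positive off the origin.\<close>
    have "AE y in lborel. ennreal (1 - exp (- (norm y)\<^sup>2)) * K y \<noteq> \<infinity>"
      by (rule nn_integral_PInf_AE) (use fin_K in auto)
    with AE_lborel_singleton[of 0] show ?thesis
    proof eventually_elim
      case (elim y)
      thus ?case by (cases "K y") (auto simp: f_K ennreal_mult_eq_top_iff)
    qed
  qed
  define \<Lambda> where "\<Lambda> = density lborel (\<lambda>y. ennreal (f y))"
  have sets_\<Lambda> [measurable_cong]: "sets \<Lambda> = sets borel" by (simp add: \<Lambda>_def)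
  have nn_\<Lambda>: "(\<integral>\<^sup>+y. g y \<partial>\<Lambda>) = (\<integral>\<^sup>+y. g y * K y \<partial>lborel)"
    if [measurable]: "g \<in> borel_measurable borel" for g
  proof -
    have "(\<integral>\<^sup>+y. g y \<partial>\<Lambda>) = (\<integral>\<^sup>+y. ennreal (f y) * g y \<partial>lborel)"
      unfolding \<Lambda>_def by (rule nn_integral_density) measurable
    also have "\<dots> = (\<integral>\<^sup>+y. g y * K y \<partial>lborel)"
      by (rule nn_integral_cong_AE) (use f_AE in eventually_elim, simp add: mult.commute)
    finally show ?thesis .
  qed

  have fin_\<Lambda>: "(\<integral>\<^sup>+y. ennreal (min 1 ((norm y)\<^sup>2)) \<partial>\<Lambda>) < \<infinity>"
  proof -
    \<comment> \<open>With this constant \<open>c * (1 - exp (- s))\<close> agrees with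
      \<open>min 1 s\<close> at \<open>s = 0\<close> and \<open>s = 1\<close>. Between them
      convexity of \<open>exp\<close> gives the inequality, beyond 1 monotonicity does.\<close>
    define c :: real where "c = 1 / (1 - exp (- 1))"
    have c: "c \<ge> 1" by (simp add: c_def field_simps)
    have "(\<integral>\<^sup>+y. ennreal (min 1 ((norm y)\<^sup>2)) \<partial>\<Lambda>) \<le> (\<integral>\<^sup>+y. ennreal c * ennreal (1 - exp (- (norm y)\<^sup>2)) \<partial>\<Lambda>)"
    proof (rule nn_integral_mono)
      fix y :: 'a
      let ?s = "(norm y)\<^sup>2"
      have "min 1 ?s \<le> c * (1 - exp (- ?s))"
      proof (cases "?s \<le> 1")
        case True
        have "exp ((1 - ?s) *\<^sub>R 0 + ?s *\<^sub>R (- 1)) \<le> (1 - ?s) * exp 0 + ?s * exp (- 1 :: real)"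
          using True by (intro convex_onD[OF exp_convex]) auto
        thus ?thesis using True by (simp add: c_def field_simps)
      next
        case False
        have "exp (- ?s) \<le> exp (- 1)" using False by simp
        hence "c * (1 - exp (- 1)) \<le> c * (1 - exp (- ?s))" using c by (intro mult_left_mono) auto
        thus ?thesis using False by (simp add: c_def)
      qed
      thus "ennreal (min 1 ?s) \<le> ennreal c * ennreal (1 - exp (- ?s))"
        using c by (subst ennreal_mult'[symmetric]) (auto intro!: ennreal_leI)
    qed
    also have "\<dots> = ennreal c * (\<integral>\<^sup>+y. ennreal (1 - exp (- (norm y)\<^sup>2)) \<partial>\<Lambda>)"
      by (rule nn_integral_cmult) measurable
    also have "\<dots> < \<infinity>"
      using fin_K by (subst nn_\<Lambda>) (auto simp: ennreal_mult_less_top)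
    finally show ?thesis .
  qed

  have khintchine: "(\<integral>y. (iexp (\<xi> \<bullet> y) - 1 - \<i> * of_real (\<xi> \<bullet> y * indicator (cball 0 1) y)) \<partial>\<Lambda>) =
     - of_real (\<psi> ((norm \<xi>)\<^sup>2))" for \<xi>
  proof -
    define h where "h y = iexp (\<xi> \<bullet> y) - 1 - \<i> * of_real (\<xi> \<bullet> y * indicator (cball 0 1) y)" for y
    have [measurable]: "cball (0::'a) 1 \<in> sets borel" by (intro borel_closed closed_cball)
    have [measurable]: "h \<in> borel_measurable borel" unfolding h_def by measurable
    have [measurable]: "(\<lambda>y. cnj (h y)) \<in> borel_measurable borel"
      by (rule borel_measurable_continuous_on[of cnj]) (intro continuous_on_cnj continuous_on_id, measurable)
    \<comment> \<open>Inside the unit ball the linear term is compensated and a second-order Taylor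
      remainder is left; outside there is no compensation and 2 is a bound.\<close>
    have h_bound: "norm (h y) \<le> (2 + (norm \<xi>)\<^sup>2) * min 1 ((norm y)\<^sup>2)" for y
    proof (cases "norm y \<le> 1")
      case True
      have "norm (h y) \<le> \<bar>\<xi> \<bullet> y\<bar>\<^sup>2 / 2"
        using iexp_approx1[of "\<xi> \<bullet> y" 1] True by (simp add: h_def numeral_2_eq_2 diff_diff_eq)
      also have "\<dots> \<le> (norm \<xi> * norm y)\<^sup>2"
        using power_mono[OF Cauchy_Schwarz_ineq2[of \<xi> y] abs_ge_zero, of 2]
          zero_le_power2[of "norm \<xi> * norm y"] unfolding power2_abs by linarith
      also have "\<dots> \<le> (2 + (norm \<xi>)\<^sup>2) * (norm y)\<^sup>2"
        by (auto simp: power_mult_distrib intro!: mult_right_mono)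
      finally show ?thesis using True by (simp add: min_absorb2 power_le_one)
    next
      case False
      have "norm (h y) \<le> norm (iexp (\<xi> \<bullet> y)) + norm (1::complex)"
        using False norm_triangle_ineq4[of "iexp (\<xi> \<bullet> y)" 1] by (simp add: h_def)
      also have "\<dots> \<le> 2 + (norm \<xi>)\<^sup>2" by simp
      finally have "norm (h y) \<le> 2 + (norm \<xi>)\<^sup>2" .
      moreover have "1 \<le> (norm y)\<^sup>2" using False by (intro one_le_power) auto
      ultimately show ?thesis by (simp add: min_def)
    qed
    have h_int: "integrable \<Lambda> h"
    proof (rule integrableI_bounded)
      have "(\<integral>\<^sup>+y. ennreal (norm (h y)) \<partial>\<Lambda>) \<le> (\<integral>\<^sup>+y. ennreal (2 + (norm \<xi>)\<^sup>2) * ennreal (min 1 ((norm y)\<^sup>2)) \<partial>\<Lambda>)"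
        by (intro nn_integral_mono order.trans[OF ennreal_leI[OF h_bound]], subst ennreal_mult') auto
      also have "\<dots> = ennreal (2 + (norm \<xi>)\<^sup>2) * (\<integral>\<^sup>+y. ennreal (min 1 ((norm y)\<^sup>2)) \<partial>\<Lambda>)"
        by (rule nn_integral_cmult) measurable
      also have "\<dots> < \<infinity>" using fin_\<Lambda> by (simp add: ennreal_mult_less_top)
      finally show "(\<integral>\<^sup>+y. ennreal (norm (h y)) \<partial>\<Lambda>) < \<infinity>" .
    qed measurable
    \<comment> \<open>The reflection \<open>y \<mapsto> - y\<close> preserves Lebesgue measure and
      \<open>f\<close>, and turns \<open>h\<close> into its conjugate, so the integral equals its
      own conjugate.\<close>
    have "Im (integral\<^sup>L \<Lambda> h) = 0"
    proof -
      have [simp]: "indicator (cball 0 1) (- y) = (indicator (cball 0 1) y :: real)" for y :: 'a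
        by (simp add: indicator_def)
      have "integral\<^sup>L \<Lambda> h = (\<integral>y. f y *\<^sub>R h y \<partial>lborel)"
        unfolding \<Lambda>_def by (rule integral_density) (auto simp: f_nonneg)
      also have "\<dots> = (\<integral>y. f y *\<^sub>R h y \<partial>distr lborel borel (\<lambda>y. 0 + (- 1) *\<^sub>R y))"
        by (subst lborel_affine[of "- 1" "0 :: 'a"]) (simp_all add: density_1)
      also have "\<dots> = (\<integral>y. f y *\<^sub>R h (- y) \<partial>lborel)"
        by (subst integral_distr) (simp_all add: f_even)
      also have "\<dots> = (\<integral>y. f y *\<^sub>R cnj (h y) \<partial>lborel)"
        by (simp add: h_def exp_cnj)
      also have "\<dots> = (\<integral>y. cnj (h y) \<partial>\<Lambda>)"
        unfolding \<Lambda>_def by (rule integral_density[symmetric]) (auto simp: f_nonneg)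
      also have "\<dots> = cnj (integral\<^sup>L \<Lambda> h)" by simp
      finally have "Im (integral\<^sup>L \<Lambda> h) = Im (cnj (integral\<^sup>L \<Lambda> h))" by (rule arg_cong)
      thus ?thesis by simp
    qed
    moreover have "Re (integral\<^sup>L \<Lambda> h) = - \<psi> ((norm \<xi>)\<^sup>2)"
    proof -
      \<comment> \<open>The truncation term is purely imaginary, so the real part of
        \<open>h\<close> is just \<open>cos (\<xi> \<bullet> y) - 1\<close>.\<close>
      have "Re (integral\<^sup>L \<Lambda> h) = - (\<integral>y. 1 - cos (\<xi> \<bullet> y) \<partial>\<Lambda>)"
        by (subst integral_Re[OF h_int, symmetric], subst Bochner_Integration.integral_minus[symmetric])
           (simp add: h_def Re_exp)
      also have "(\<integral>y. 1 - cos (\<xi> \<bullet> y) \<partial>\<Lambda>) = enn2real (\<integral>\<^sup>+y. ennreal (1 - cos (\<xi> \<bullet> y)) \<partial>\<Lambda>)"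
        by (rule integral_eq_nn_integral) auto
      also have "(\<integral>\<^sup>+y. ennreal (1 - cos (\<xi> \<bullet> y)) \<partial>\<Lambda>) =
        (\<integral>\<^sup>+t. \<integral>\<^sup>+y. ennreal (1 - cos (\<xi> \<bullet> y)) * ennreal (heat_kernel t y) \<partial>lborel \<partial>\<nu>)"
        by (subst nn_\<Lambda>, measurable) (rule fubini, measurable)
      also have "\<dots> = (\<integral>\<^sup>+t. ennreal (1 - exp (- (norm \<xi>)\<^sup>2 * t)) \<partial>\<nu>)"
      proof (rule nn_integral_cong_AE)
        show "AE t in \<nu>. (\<integral>\<^sup>+y. ennreal (1 - cos (\<xi> \<bullet> y)) * ennreal (heat_kernel t y) \<partial>lborel) = ennreal (1 - exp (- (norm \<xi>)\<^sup>2 * t))"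
          using AE_pos
        proof eventually_elim
          case (elim t)
          have "(\<integral>\<^sup>+y. ennreal (1 - cos (\<xi> \<bullet> y)) * ennreal (heat_kernel t y) \<partial>lborel) =
            (\<integral>\<^sup>+y. ennreal (heat_kernel t y * (1 - cos (\<xi> \<bullet> y))) \<partial>lborel)"
            by (intro nn_integral_cong) (simp add: ennreal_mult'[OF heat_kernel_nonneg] mult.commute)
          thus ?case using nn_integral_heat_kernel_cos[OF elim, of \<xi>] by (simp add: mult.commute)
        qed
      qed
      also have "\<dots> = ennreal (\<psi> ((norm \<xi>)\<^sup>2))"
      \<comment> \<open>The Laplace identity \<open>lap\<close> covers positive arguments; at the
        origin both sides are 0 by \<open>\<psi> 0 = 0\<close>.\<close>
      proof (cases "\<xi> = 0")
        case False
        thus ?thesis by (intro lap) simp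
      qed (simp add: \<psi>)
      finally show ?thesis
        by (cases "\<xi> = 0") (simp_all add: \<psi>)
    qed
    ultimately show ?thesis
      unfolding h_def[symmetric] by (simp add: complex_eq_iff)
  qed

  have "emeasure \<Lambda> {0} = 0"
    unfolding \<Lambda>_def by (subst emeasure_density) (auto intro!: nn_integral_null_set finite_imp_null_set_lborel)
  moreover have "has_characteristic_exponent N X (\<lambda>\<xi>. of_real (\<xi> \<bullet> 0 / 2) - \<i> * of_real (0 \<bullet> \<xi>) -
    (\<integral>y. (iexp (\<xi> \<bullet> y) - 1 - \<i> * of_real (\<xi> \<bullet> y * indicator (cball 0 1) y)) \<partial>\<Lambda>))"
    unfolding khintchine using char by simp
  ultimately have "has_levy_measure N X \<Lambda>"
    unfolding has_levy_measure_def using sets_\<Lambda> fin_\<Lambda>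
    by (intro conjI exI[of _ "\<lambda>_. 0"] exI[of _ 0]) (auto simp: linear_zero)
  thus ?thesis
    unfolding has_levy_density_def f_def[symmetric] \<Lambda>_def using f_nonneg by auto
qed

section \<open>Asymptotics of the kernel at the origin and conclusion\<close>

lemma levy_kernel_asymp_equiv:
  assumes d: "d > 0"
    and kernel: "\<And>r. levy_kernel d \<mu> r = enn2real (\<integral>\<^sup>+t. ennreal ((4 * pi * t) powr (- real d / 2) * exp (- r\<^sup>2 / (4 * t))) \<partial>levy_mixture)"
  shows "levy_kernel d \<mu> \<sim>[at_right 0]
           (\<lambda>r. 4 * Gamma (real d / 2 + 1) / pi powr (real d / 2) * (1 / (r ^ (d + 2) * (ln (1 / r\<^sup>2))\<^sup>2)))"
proof -
  define q where "q = real d / 2"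
  \<comment> \<open>Chosen so that \<open>exp (- L r)\<close> is \<open>r\<^sup>2 / 4\<close>, the
    coefficient of \<open>1 / t\<close> in the Gaussian exponent.\<close>
  define L where "L r = - ln (r\<^sup>2 / 4)" for r :: real
  define I where "I l = (\<integral>u. mixture_integrand q l u \<partial>lborel)" for l
  have q: "q > 0" using d by (simp add: q_def)
  have I: "(I \<longlongrightarrow> Gamma (q + 1)) at_top"
    unfolding I_def[abs_def] by (rule integral_mixture_integrand_tendsto[OF q])
  have L: "filterlim L at_top (at_right 0)"
    unfolding L_def by real_asymp
  have kernel_eq: "levy_kernel d \<mu> r = 4 / pi powr q * (1 / (r ^ (d + 2) * (L r)\<^sup>2)) * I (L r)"
    if "r > 0" "L r > 0" "I (L r) \<ge> 0" for r
  proof -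
    have e: "exp (- L r) = r\<^sup>2 / 4" using that by (simp add: L_def)
    have "(\<integral>\<^sup>+t. ennreal ((4 * pi * t) powr (- real d / 2) * exp (- r\<^sup>2 / (4 * t))) \<partial>levy_mixture) =
      (\<integral>\<^sup>+t. ennreal ((4 * pi) powr (- q)) * ennreal (t powr (- q) * exp (- exp (- L r) / t)) \<partial>levy_mixture)"
    proof (rule nn_integral_cong_AE)
      show "AE t in levy_mixture. ennreal ((4 * pi * t) powr (- real d / 2) * exp (- r\<^sup>2 / (4 * t))) =
        ennreal ((4 * pi) powr (- q)) * ennreal (t powr (- q) * exp (- exp (- L r) / t))"
        using AE_levy_mixture_pos
        by eventually_elim (simp add: e q_def powr_mult ennreal_mult'[symmetric] mult_ac)
    qed
    also have "\<dots> = ennreal ((4 * pi) powr (- q)) * (\<integral>\<^sup>+t. ennreal (t powr (- q) * exp (- exp (- L r) / t)) \<partial>levy_mixture)"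
      by (rule nn_integral_cmult) measurable
    also have "\<dots> = ennreal ((4 * pi) powr (- q) * (exp ((q + 1) * L r) / (L r)\<^sup>2 * I (L r)))"
      unfolding nn_integral_heat_levy_mixture[OF q that(2)] I_def by (rule ennreal_mult'[symmetric]) simp
    finally have "levy_kernel d \<mu> r = (4 * pi) powr (- q) * (exp ((q + 1) * L r) / (L r)\<^sup>2 * I (L r))"
      using that(3) by (simp add: kernel)
    \<comment> \<open>Here \<open>exp ((q + 1) * L r)\<close> is the power \<open>q + 1\<close> of
      \<open>4 / r\<^sup>2\<close>, and \<open>2 * (q + 1) = d + 2\<close> gives the power of
      \<open>r\<close>. The powers of 4 combine to the single constant 4.\<close>
    moreover have "(4 * pi) powr (- q) * exp ((q + 1) * L r) = 4 / pi powr q * (1 / r ^ (d + 2))"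
    proof -
      have 1: "exp ((q + 1) * L r) = 4 powr (q + 1) / (r\<^sup>2) powr (q + 1)"
        using that(1) by (simp add: L_def powr_def ln_div exp_diff[symmetric] algebra_simps)
      have 2: "(r\<^sup>2) powr (q + 1) = r ^ (d + 2)"
      proof -
        have "(r\<^sup>2) powr (q + 1) = r powr (2 * (q + 1))"
          using that(1) powr_powr[of r 2 "q + 1"] by simp
        also have "2 * (q + 1) = real (d + 2)" by (simp add: q_def)
        also have "r powr real (d + 2) = r ^ (d + 2)" using that(1) by (rule powr_realpow)
        finally show ?thesis .
      qed
      have 3: "(4 * pi) powr (- q) * 4 powr (q + 1) = 4 / pi powr q"
        by (simp add: powr_mult powr_add powr_minus field_simps)
      show ?thesis by (simp only: 1 2 3 times_divide_eq_right mult_1_right)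
    qed
    ultimately show ?thesis by (simp add: field_simps)
  qed
  have G: "Gamma (q + 1) > 0" using q by (intro Gamma_real_pos) auto
  \<comment> \<open>\<open>L r\<close> exceeds \<open>ln (1 / r\<^sup>2)\<close> only by the
    constant \<open>ln 4\<close>, so their quotient tends to 1 and one logarithm may replace the
    other.\<close>
  have "((\<lambda>r. I (L r) / Gamma (q + 1) * (ln (1 / r\<^sup>2) / L r)\<^sup>2) \<longlongrightarrow> Gamma (q + 1) / Gamma (q + 1) * 1\<^sup>2) (at_right 0)"
  proof (intro tendsto_intros)
    show "((\<lambda>r. I (L r)) \<longlongrightarrow> Gamma (q + 1)) (at_right 0)"
      by (rule filterlim_compose[OF I L])
    show "((\<lambda>r. ln (1 / r\<^sup>2) / L r) \<longlongrightarrow> 1) (at_right 0)"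
      unfolding L_def by real_asymp
  qed (use G in auto)
  \<comment> \<open>The closed form \<open>kernel_eq\<close> asks for \<open>L r > 0\<close> and
    \<open>I (L r) \<ge> 0\<close>; both hold near 0, the second because the limit
    \<open>Gamma (q + 1)\<close> is positive.\<close>
  moreover have "eventually (\<lambda>r. I (L r) / Gamma (q + 1) * (ln (1 / r\<^sup>2) / L r)\<^sup>2 =
      levy_kernel d \<mu> r / (4 * Gamma (q + 1) / pi powr q * (1 / (r ^ (d + 2) * (ln (1 / r\<^sup>2))\<^sup>2)))) (at_right 0)"
  proof -
    have 1: "eventually (\<lambda>r::real. r > 0) (at_right 0)" by (rule eventually_at_right_less)
    have 2: "eventually (\<lambda>r. L r > 0) (at_right 0)"
      using L by (simp add: filterlim_at_top_dense)
    have 3: "eventually (\<lambda>r. I (L r) > 0) (at_right 0)"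
      using filterlim_compose[OF I L] G by (rule order_tendstoD(1))
    have 4: "eventually (\<lambda>r::real. ln (1 / r\<^sup>2) > 0) (at_right 0)" by real_asymp
    show ?thesis
      using 1 2 3 4
    proof eventually_elim
      case (elim r)
      thus ?case using G by (simp add: kernel_eq field_simps)
    qed
  qed
  ultimately have "((\<lambda>r. levy_kernel d \<mu> r / (4 * Gamma (q + 1) / pi powr q * (1 / (r ^ (d + 2) * (ln (1 / r\<^sup>2))\<^sup>2)))) \<longlongrightarrow> 1) (at_right 0)"
    using G by (simp add: tendsto_cong)
  thus ?thesis
    unfolding q_def by (rule asymp_equivI')
qed

theorem proposition2p1:
  fixes M :: "'w measure" and S :: "real \<Rightarrow> 'w \<Rightarrow> real" and \<mu> :: "real \<Rightarrow> real"
  assumes dim: "CARD('d::finite) \<ge> 3"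
    and sub: "subordinator M S"
    and lap: "has_laplace_exponent M S phi"
    and dens: "has_subordinator_levy_density M S \<mu>"
    and pos: "\<And>t. t > 0 \<Longrightarrow> \<mu> t > 0"
    and cm: "completely_monotone \<mu>"
  shows "(\<forall>(N :: 'v measure) (X :: real \<Rightarrow> 'v \<Rightarrow> real ^ 'd) x.
            levy_process N x X \<and>
            has_characteristic_exponent N X (\<lambda>\<xi>. of_real (phi ((norm \<xi>)\<^sup>2))) \<longrightarrow>
            has_levy_density N X (\<lambda>y. levy_kernel CARD('d) \<mu> (norm y)))
       \<and> levy_kernel CARD('d) \<mu> \<sim>[at_right 0]
           (\<lambda>r. 4 * Gamma (real CARD('d) / 2 + 1) / pi powr (real CARD('d) / 2)
                * (1 / (r ^ (CARD('d) + 2) * (ln (1 / r\<^sup>2))\<^sup>2)))"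
proof -
  define \<nu> where "\<nu> = density lborel (\<lambda>t. ennreal (indicator {0<..} t * \<mu> t))"
  have meas: "(\<lambda>t. indicator {0<..} t * \<mu> t) \<in> borel_measurable borel"
    using dens by (simp add: has_subordinator_levy_density_def set_borel_measurable_def)
  have nonneg: "0 \<le> \<mu> t" if "t > 0" for t using pos[OF that] by simp
  have lm: "has_subordinator_levy_measure M S \<nu>"
    using dens by (simp add: has_subordinator_levy_density_def \<nu>_def)
  have fin: "(\<integral>\<^sup>+t. ennreal (min 1 t) \<partial>\<nu>) < \<infinity>"
    using lm by (simp add: has_subordinator_levy_measure_def)
  have laplace: "(\<integral>\<^sup>+t. ennreal (1 - exp (- l * t)) \<partial>\<nu>) = ennreal (phi l)" if "l > 0" for l
    by (rule subordinator_laplace[OF lap lm that])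
  have phi: "phi 0 = 0" "0 \<le> phi l" if "l > 0" for l
    using that ln_add_one_self_le_self[of l] by (simp_all add: phi_def field_simps)
  have "\<nu> = levy_mixture"
  proof (rule levy_measure_eqI)
    show "AE t in \<nu>. t > 0"
      unfolding \<nu>_def using meas by (subst AE_density) (auto split: split_indicator_asm)
    show "sets \<nu> = sets borel" by (simp add: \<nu>_def)
  next
    fix l :: real assume l: "l > 0"
    show "(\<integral>\<^sup>+t. ennreal (1 - exp (- l * t)) \<partial>\<nu>) = (\<integral>\<^sup>+t. ennreal (1 - exp (- l * t)) \<partial>levy_mixture)"
      by (simp only: laplace[OF l] laplace_levy_mixture[OF l])
    show "(\<integral>\<^sup>+t. ennreal (1 - exp (- l * t)) \<partial>\<nu>) < \<infinity>"
      by (simp only: laplace[OF l]) simp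
  qed (simp_all add: sets_levy_mixture AE_levy_mixture_pos)
  \<comment> \<open>Equality of the measures determines \<open>\<mu>\<close> only almost everywhere,
    which suffices since the kernel depends on \<open>\<mu>\<close> through integrals against
    \<open>\<nu>\<close>.\<close>
  hence "levy_kernel CARD('d) \<mu> r = enn2real (\<integral>\<^sup>+t. ennreal ((4 * pi * t) powr (- real CARD('d) / 2) *
      exp (- r\<^sup>2 / (4 * t))) \<partial>levy_mixture)" for r
    using levy_kernel_eq[OF meas nonneg] by (simp add: \<nu>_def)
  hence "levy_kernel CARD('d) \<mu> \<sim>[at_right 0]
           (\<lambda>r. 4 * Gamma (real CARD('d) / 2 + 1) / pi powr (real CARD('d) / 2)
                * (1 / (r ^ (CARD('d) + 2) * (ln (1 / r\<^sup>2))\<^sup>2)))"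
    using dim by (intro levy_kernel_asymp_equiv) auto
  moreover have "has_levy_density N X (\<lambda>y. levy_kernel CARD('d) \<mu> (norm y))"
    if "has_characteristic_exponent N X (\<lambda>\<xi>. of_real (phi ((norm \<xi>)\<^sup>2)))"
    for N :: "'v measure" and X :: "real \<Rightarrow> 'v \<Rightarrow> real ^ 'd"
    \<comment> \<open>The premise \<open>l > 0\<close> is attached to both parts of the fact
      \<open>phi\<close>; instantiating the first at 1 leaves \<open>0 < 1\<close> to the
      simplifier.\<close>
    using has_levy_density_levy_kernel[OF meas nonneg \<nu>_def fin laplace phi(1)[of 1] phi(2) that] by simp
  ultimately show ?thesis by blast
qed

end
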